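(* Let $x_0\in\mathbb R^d$ and let $B$ be a symmetric positive definite $d\times d$ matrix. If $\rho_t$ solves $$\partial_t\rho_t=\nabla\cdot\big(\mathrm C(\rho_t)(\nabla\rho_t+\rho_tB^{-1}(x-x_0))\big),$$ then, with $m_t=\mathrm M(\rho_t)$, $C_t=\mathrm C(\rho_t)$ and $A_t$ a left square root of $C_t$ (i.e. $A_tA_t^{\mathsf T}=C_t$) solving $$A_t^{-1}\dot A_t=\tfrac12A_t^{-1}\dot C_tA_t^{-\mathsf T}=\mathrm{Id}-A_t^{\mathsf T}B^{-1}A_t,$$ the normalized solution $\eta_t=(T_{m_t,A_t})_\#\rho_t$, where $T_{m,A}(x)=A^{-1}(x-m)$, satisfies the Ornstein–Uhlenbeck evolution $$\partial_t\eta_t=\Delta\eta_t+\nabla\cdot(x\,\eta_t).$$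
   Context: $\rho_t$ is a curve of probability measures on $\mathbb R^d$ with finite second moment and positive definite covariance, identified with their densities. $\mathrm M(\rho)=\int x\,d\rho$, $\mathrm C(\rho)=\int(x-\mathrm M(\rho))\otimes(x-\mathrm M(\rho))\,d\rho$. Along the equation the moments satisfy $\dot m_t=-C_tB^{-1}(m_t-x_0)$ and $\dot C_t=2C_t-2C_tB^{-1}C_t$. *)

theory Defs
  imports "HOL-Probability.Probability"
begin

definition pos_def :: "real^'n^'n \<Rightarrow> bool" where
  "pos_def B \<longleftrightarrow> transpose B = B \<and> (\<forall>x. x \<noteq> 0 \<longrightarrow> 0 < x \<bullet> (B *v x))"

definition mean :: "(real^'n) measure \<Rightarrow> real^'n" where
  "mean \<mu> = (\<integral>x. x \<partial>\<mu>)"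

definition outer :: "real^'n \<Rightarrow> real^'n \<Rightarrow> real^'n^'n" where
  "outer x y = (\<chi> i j. x $ i * y $ j)"

definition cov :: "(real^'n) measure \<Rightarrow> real^'n^'n" where
  "cov \<mu> = (\<integral>x. outer (x - mean \<mu>) (x - mean \<mu>) \<partial>\<mu>)"

definition P2pos :: "(real^'n) measure set" where
  "P2pos = {\<mu>. prob_space \<mu> \<and> sets \<mu> = sets borel \<and>
     integrable \<mu> (\<lambda>x. (norm x)\<^sup>2) \<and> pos_def (cov \<mu>)}"

definition normalization :: "real^'n \<Rightarrow> real^'n^'n \<Rightarrow> real^'n \<Rightarrow> real^'n" where
  "normalization m A x = matrix_inv A *v (x - m)"

definition pderiv_at :: "'n \<Rightarrow> (real^'n \<Rightarrow> real) \<Rightarrow> real^'n \<Rightarrow> real" where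
  "pderiv_at i \<phi> x = frechet_derivative \<phi> (at x) (axis i 1)"

primrec Ck :: "nat \<Rightarrow> (real^'n \<Rightarrow> real) \<Rightarrow> bool" where
  "Ck 0 \<phi> \<longleftrightarrow> continuous_on UNIV \<phi>"
| "Ck (Suc k) \<phi> \<longleftrightarrow> (\<forall>x. \<phi> differentiable (at x)) \<and> (\<forall>i. Ck k (pderiv_at i \<phi>))"

definition test_function :: "(real^'n \<Rightarrow> real) \<Rightarrow> bool" where
  "test_function \<phi> \<longleftrightarrow> (\<forall>k. Ck k \<phi>) \<and> compact (closure {x. \<phi> x \<noteq> 0})"

text \<open>Distributions on Euclidean space are represented by their action on test functions:
  scalar ones as real-valued functionals, vector fields as functionals with values in the
  space itself. A measure \<open>\<mu>\<close> (equivalently its density, if it has one) acts by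
  integration. The differential operators carry the sign from integration by parts.\<close>

type_synonym 'n sdistr = "(real^'n \<Rightarrow> real) \<Rightarrow> real"
type_synonym 'n vdistr = "(real^'n \<Rightarrow> real) \<Rightarrow> real^'n"

definition meas :: "(real^'n) measure \<Rightarrow> 'n sdistr" where
  "meas \<mu> \<phi> = (\<integral>x. \<phi> x \<partial>\<mu>)"

text \<open>The vector field \<open>b \<mu>\<close>.\<close>

definition meas_field :: "(real^'n \<Rightarrow> real^'n) \<Rightarrow> (real^'n) measure \<Rightarrow> 'n vdistr" where
  "meas_field b \<mu> \<phi> = (\<integral>x. \<phi> x *\<^sub>R b x \<partial>\<mu>)"

definition ddiv :: "'n::finite vdistr \<Rightarrow> 'n sdistr" where
  "ddiv F \<phi> = - (\<Sum>i\<in>UNIV. F (pderiv_at i \<phi>) $ i)"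

definition dgrad :: "'n::finite sdistr \<Rightarrow> 'n vdistr" where
  "dgrad u \<phi> = (\<chi> i. - u (pderiv_at i \<phi>))"

definition dlaplace :: "'n::finite sdistr \<Rightarrow> 'n sdistr" where
  "dlaplace u = ddiv (dgrad u)"

text \<open>\<open>\<partial>\<^sub>t \<rho>\<^sub>t = R\<^sub>t\<close> on the set \<open>I\<close> of times, in the sense of distributions: every pairing with a
  fixed test function is differentiable in time (one-sidedly at an end point that belongs
  to \<open>I\<close>). For a narrowly continuous curve and the right-hand sides used here, with
  coefficients continuous in time, this agrees with testing against functions of space and time.\<close>

definition has_time_derivative ::
    "(real \<Rightarrow> (real^'n) measure) \<Rightarrow> (real \<Rightarrow> 'n sdistr) \<Rightarrow> real set \<Rightarrow> bool" where
  "has_time_derivative \<rho> R I \<longleftrightarrow> (\<forall>\<phi>. test_function \<phi> \<longrightarrow>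
     (\<forall>t\<in>I. ((\<lambda>s. meas (\<rho> s) \<phi>) has_real_derivative R t \<phi>) (at t within I)))"

definition solves_cov_fokker_planck ::
    "real^'n \<Rightarrow> real^'n^'n \<Rightarrow> (real \<Rightarrow> (real^'n) measure) \<Rightarrow> real set \<Rightarrow> bool" where
  "solves_cov_fokker_planck x0 B \<rho> I \<longleftrightarrow> has_time_derivative \<rho>
     (\<lambda>t. ddiv (\<lambda>\<phi>. cov (\<rho> t) *v
        (dgrad (meas (\<rho> t)) \<phi> + meas_field (\<lambda>x. matrix_inv B *v (x - x0)) (\<rho> t) \<phi>))) I"

definition solves_ornstein_uhlenbeck :: "(real \<Rightarrow> (real^'n) measure) \<Rightarrow> real set \<Rightarrow> bool" where
  "solves_ornstein_uhlenbeck \<eta> I \<longleftrightarrow> has_time_derivative \<eta>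
     (\<lambda>t \<phi>. dlaplace (meas (\<eta> t)) \<phi> + ddiv (meas_field (\<lambda>x. x) (\<eta> t)) \<phi>) I"

end

theory Submission
  imports Defs
begin

text \<open>
  Fix a test function \<open>\<phi>\<close> and write \<open>P\<^sub>t = A\<^sub>t\<^sup>-\<^sup>1\<close> and \<open>T\<^sub>t x = P\<^sub>t (x - m\<^sub>t)\<close>, so that the pairing of the
  normalized curve with \<open>\<phi>\<close> is \<open>\<integral> \<phi> (T\<^sub>t x) d\<rho>\<^sub>t\<close>. Both the integrand and the measure move. The
  measure contributes the equation of \<open>\<rho>\<close> tested with the function \<open>\<phi> \<circ> T\<^sub>t\<close>, which is again a test
  function because \<open>T\<^sub>t\<close> is an invertible affine map; the integrand contributes
  \<open>\<integral> \<nabla>\<phi> (T\<^sub>t x) \<bullet> (\<partial>\<^sub>t T\<^sub>t) x d\<rho>\<^sub>t\<close>. This is the chain rule \<open>moving_affine_pairing\<close>: by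
  Taylor's formula the error is quadratic in the time step, up to a factor that is a second moment
  of \<open>\<rho>\<^sub>s\<close>, and second moments are locally bounded in time.

  The rest is algebra. The two equations for \<open>A\<close> give \<open>P A' = Id - A\<^sup>T B\<^sup>-\<^sup>1 A\<close>, hence
  \<open>P' = - (Id - A\<^sup>T B\<^sup>-\<^sup>1 A) P\<close>, and \<open>P C = A\<^sup>T\<close> because \<open>C = A A\<^sup>T\<close>. With \<open>y = T\<^sub>t x\<close> and
  \<open>m' = - C B\<^sup>-\<^sup>1 (m - x\<^sub>0)\<close> the velocity \<open>\<partial>\<^sub>t T\<^sub>t x\<close> becomes \<open>- y + A\<^sup>T B\<^sup>-\<^sup>1 (x - x\<^sub>0)\<close>. The drift of
  the equation of \<open>\<rho>\<close>, transported by \<open>T\<^sub>t\<close>, is \<open>- A\<^sup>T B\<^sup>-\<^sup>1 (x - x\<^sub>0)\<close> and cancels the last term, while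
  its diffusion matrix becomes \<open>P C P\<^sup>T = Id\<close>. What is left is \<open>\<Delta>\<phi> (y) - y \<bullet> \<nabla>\<phi> (y)\<close>, the
  Ornstein-Uhlenbeck generator.

  The differential equation for the mean has to be derived from the weak equation, which only
  speaks about compactly supported functions (\<open>mean_has_derivative\<close>). A single test function
  \<open>\<kappa>\<close> with \<open>\<kappa> 0 = 1\<close> suffices as a cutoff: \<open>x\<^sub>k \<kappa> (\<epsilon> x)\<close> approximates the coordinate \<open>x\<^sub>k\<close> together
  with its first two derivatives up to an error of order \<open>\<epsilon>\<close> times a power of \<open>1 + |x|\<close>
  (\<open>cutoff_coordinate\<close>). Such a \<open>\<kappa>\<close> is obtained from the given \<open>\<phi>\<close> by translation and scaling,
  unless \<open>\<phi> = 0\<close>, when there is nothing to prove. As only the covariance is known to be continuous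
  in time, a local bound on the mean comes first (\<open>weight_locally_bounded\<close>): mass cannot leave a
  ball suddenly, and by Chebyshev's inequality most of it stays at bounded distance from the mean.
  The mean value inequality in time, applied before removing the cutoff, then gives the equation
  for the mean.
\<close>

section \<open>Test functions and their derivatives\<close>

lemma pderiv_at_eq:
  assumes "(\<phi> has_derivative D) (at x)"
  shows "pderiv_at i \<phi> x = D (axis i 1)"
  using frechet_derivative_at[OF assms] by (simp add: pderiv_at_def)

lemma has_derivative_pderiv_at:
  fixes \<phi> :: "real^'n \<Rightarrow> real"
  assumes "\<phi> differentiable (at x)"
  shows "(\<phi> has_derivative (\<lambda>h. \<Sum>i\<in>UNIV. h $ i * pderiv_at i \<phi> x)) (at x)"
proof -
  obtain D where D: "(\<phi> has_derivative D) (at x)"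
    using assms by (auto simp: differentiable_def)
  interpret bounded_linear D using D by (rule has_derivative_bounded_linear)
  have "D h = (\<Sum>i\<in>UNIV. h $ i * pderiv_at i \<phi> x)" for h
  proof -
    have "D h = D (\<Sum>i\<in>UNIV. (h $ i) *\<^sub>R axis i 1)"
      using basis_expansion[of h] by (simp add: scalar_mult_eq_scaleR)
    also have "\<dots> = (\<Sum>i\<in>UNIV. h $ i * D (axis i 1))"
      by (simp add: sum scaleR)
    finally show ?thesis by (simp add: pderiv_at_eq[OF D])
  qed
  then have "D = (\<lambda>h. \<Sum>i\<in>UNIV. h $ i * pderiv_at i \<phi> x)" by blast
  with D show ?thesis by simp
qed

lemma pderiv_at_sum:
  assumes "finite J" "\<And>j. j \<in> J \<Longrightarrow> f j differentiable (at x)"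
  shows "pderiv_at i (\<lambda>x. \<Sum>j\<in>J. c j * f j x) x = (\<Sum>j\<in>J. c j * pderiv_at i (f j) x)"
proof -
  have "((\<lambda>x. \<Sum>j\<in>J. c j * f j x) has_derivative
      (\<lambda>h. \<Sum>j\<in>J. c j * (\<Sum>i\<in>UNIV. h $ i * pderiv_at i (f j) x))) (at x)"
    using assms by (intro has_derivative_sum has_derivative_mult_right has_derivative_pderiv_at)
  from pderiv_at_eq[OF this] show ?thesis
    by (simp add: axis_def if_distrib[of "\<lambda>z. z * _"] cong: if_cong)
qed

lemma pderiv_at_coordinate_mult:
  assumes "\<phi> differentiable (at x)"
  shows "pderiv_at i (\<lambda>x. x $ k * \<phi> x) x = (if i = k then \<phi> x else 0) + x $ k * pderiv_at i \<phi> x"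
proof -
  have "((\<lambda>x. x $ k * \<phi> x) has_derivative
      (\<lambda>h. x $ k * (\<Sum>i\<in>UNIV. h $ i * pderiv_at i \<phi> x) + h $ k * \<phi> x)) (at x)"
    using has_derivative_pderiv_at[OF assms]
    by (intro has_derivative_mult has_derivative_pderiv_at assms)
       (rule bounded_linear_imp_has_derivative, rule bounded_linear_vec_nth)
  from pderiv_at_eq[OF this] show ?thesis
    by (simp add: axis_def if_distrib[of "\<lambda>z. z * _"] cong: if_cong)
qed

lemma pderiv_at_affine:
  fixes P :: "real^'n^'n"
  assumes "\<phi> differentiable (at (P *v x + c))"
  shows "pderiv_at i (\<lambda>x. \<phi> (P *v x + c)) x = (\<Sum>k\<in>UNIV. P $ k $ i * pderiv_at k \<phi> (P *v x + c))"
proof -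
  have T: "((\<lambda>x. P *v x + c) has_derivative (\<lambda>h. P *v h)) (at x)"
    by (rule has_derivative_add_const, rule bounded_linear_imp_has_derivative) simp
  have "((\<lambda>x. \<phi> (P *v x + c)) has_derivative
      (\<lambda>h. \<Sum>k\<in>UNIV. (P *v h) $ k * pderiv_at k \<phi> (P *v x + c))) (at x)"
    using has_derivative_compose[OF T has_derivative_pderiv_at[OF assms]] by simp
  from pderiv_at_eq[OF this] show ?thesis
    by (simp add: matrix_vector_mult_basis column_def)
qed

lemma Ck_differentiable: "Ck (Suc k) \<phi> \<Longrightarrow> \<phi> differentiable (at x)"
  by simp

lemma Ck_Suc_imp: "Ck (Suc k) \<phi> \<Longrightarrow> Ck k \<phi>"
proof (induction k arbitrary: \<phi>)
  case 0
  then have "\<And>x. isCont \<phi> x" by (auto intro: differentiable_imp_continuous_within)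
  then show ?case by (simp add: continuous_at_imp_continuous_on)
next
  case (Suc k)
  then show ?case by simp
qed

lemma Ck_sum:
  assumes "finite J" "\<And>j. j \<in> J \<Longrightarrow> Ck k (f j)"
  shows "Ck k (\<lambda>x. \<Sum>j\<in>J. c j * f j x)"
  using assms(2)
proof (induction k arbitrary: f)
  case 0
  then show ?case by (auto intro!: continuous_intros)
next
  case (Suc k)
  have "pderiv_at i (\<lambda>x. \<Sum>j\<in>J. c j * f j x) = (\<lambda>x. \<Sum>j\<in>J. c j * pderiv_at i (f j) x)" for i
    using Suc.prems by (intro ext pderiv_at_sum[OF assms(1)]) auto
  moreover have "Ck k (\<lambda>x. \<Sum>j\<in>J. c j * pderiv_at i (f j) x)" for i
    using Suc.prems by (intro Suc.IH) auto
  ultimately show ?case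
    using Suc.prems assms(1) by (auto intro!: differentiable_sum differentiable_mult)
qed

lemma Ck_add:
  assumes "Ck k f" "Ck k g" shows "Ck k (\<lambda>x. f x + g x)"
proof -
  have "Ck k (\<lambda>x. \<Sum>j\<in>(UNIV::bool set). 1 * (if j then f else g) x)"
    using assms by (intro Ck_sum) auto
  then show ?thesis by (simp add: UNIV_bool add.commute)
qed

lemma Ck_zero: "Ck k (\<lambda>x. 0)"
  using Ck_sum[of "{}" k "\<lambda>_ _. 0" "\<lambda>_. 0"] by simp

lemma differentiable_vec_nth: "(\<lambda>x::real^'n. x $ k) differentiable (at x)"
  using bounded_linear_imp_differentiable[OF bounded_linear_vec_nth] .

text \<open>
  By the Leibniz rule the derivative of \<open>x\<^sub>l \<phi>\<close> involves \<open>\<phi>\<close> itself, which has one derivative to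
  spare, so the induction closes.
\<close>

lemma Ck_coordinate_mult: "Ck k \<phi> \<Longrightarrow> Ck k (\<lambda>x. x $ l * \<phi> x)"
proof (induction k arbitrary: \<phi>)
  case 0
  then show ?case by (auto intro!: continuous_intros)
next
  case (Suc k)
  have d: "\<phi> differentiable (at x)" for x using Suc.prems by simp
  have "pderiv_at i (\<lambda>x. x $ l * \<phi> x) = (\<lambda>x. (if i = l then \<phi> x else 0) + x $ l * pderiv_at i \<phi> x)" for i
    by (intro ext pderiv_at_coordinate_mult d)
  moreover have "Ck k (\<lambda>x. (if i = l then \<phi> x else 0) + x $ l * pderiv_at i \<phi> x)" for i
    using Ck_Suc_imp[OF Suc.prems] Suc by (intro Ck_add) (cases "i = l", simp_all add: Ck_zero)
  ultimately show ?case using d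
    by (auto intro!: differentiable_mult differentiable_vec_nth)
qed

lemma Ck_affine:
  fixes P :: "real^'n^'n"
  shows "Ck k \<phi> \<Longrightarrow> Ck k (\<lambda>x. \<phi> (P *v x + c))"
proof (induction k arbitrary: \<phi>)
  case 0
  have "continuous_on UNIV (\<phi> \<circ> (\<lambda>x. P *v x + c))"
    using 0 by (intro continuous_on_compose continuous_intros) (auto intro: continuous_on_subset)
  then show ?case by (simp add: o_def)
next
  case (Suc k)
  have d: "\<phi> differentiable (at x)" for x using Suc.prems by simp
  have "pderiv_at i (\<lambda>x. \<phi> (P *v x + c)) = (\<lambda>x. \<Sum>k\<in>UNIV. P $ k $ i * pderiv_at k \<phi> (P *v x + c))" for i
    by (intro ext pderiv_at_affine d)
  moreover have "Ck k (\<lambda>x. \<Sum>j\<in>UNIV. P $ j $ i * pderiv_at j \<phi> (P *v x + c))" for i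
    using Suc by (intro Ck_sum) auto
  moreover have "(\<lambda>x. \<phi> (P *v x + c)) differentiable (at x)" for x
  proof -
    have "(\<lambda>x. P *v x + c) differentiable (at x)"
      by (intro differentiable_add differentiable_const bounded_linear_imp_differentiable) simp
    from differentiable_chain_at[OF this d] show ?thesis by (simp add: o_def)
  qed
  ultimately show ?case by simp
qed

lemma test_function_iff: "test_function \<phi> \<longleftrightarrow> (\<forall>k. Ck k \<phi>) \<and> bounded {x. \<phi> x \<noteq> 0}"
  by (simp add: test_function_def)

lemma test_function_differentiable: "test_function \<phi> \<Longrightarrow> \<phi> differentiable (at x)"
  using Ck_differentiable unfolding test_function_def by blast

lemma test_function_continuous: "test_function \<phi> \<Longrightarrow> continuous_on UNIV \<phi>"
  unfolding test_function_def by (metis Ck.simps(1))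

text \<open>
  Outside the closed support the function vanishes on a neighbourhood, so its derivatives vanish.
\<close>

lemma test_function_pderiv_at:
  assumes "test_function \<phi>" shows "test_function (pderiv_at i \<phi>)"
proof -
  have "Ck k (pderiv_at i \<phi>)" for k
    using assms unfolding test_function_def by (metis Ck.simps(2))
  moreover have "{x. pderiv_at i \<phi> x \<noteq> 0} \<subseteq> closure {x. \<phi> x \<noteq> 0}"
  proof (rule ccontr)
    assume "\<not> ?thesis"
    then obtain x where x: "pderiv_at i \<phi> x \<noteq> 0" "x \<in> - closure {x. \<phi> x \<noteq> 0}" by auto
    have "(\<phi> has_derivative (\<lambda>h. 0)) (at x)"
    proof (rule has_derivative_transform_within_open)
      show "((\<lambda>x. 0) has_derivative (\<lambda>h. 0)) (at x)" by simp
      show "open (- closure {x. \<phi> x \<noteq> 0})" by (intro open_Compl closed_closure)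
      show "x \<in> - closure {x. \<phi> x \<noteq> 0}" by fact
      show "0 = \<phi> y" if "y \<in> - closure {x. \<phi> x \<noteq> 0}" for y
        using that closure_subset[of "{x. \<phi> x \<noteq> 0}"] by auto
    qed
    from pderiv_at_eq[OF this] x(1) show False by simp
  qed
  ultimately show ?thesis
    using assms unfolding test_function_def
    by (metis bounded_subset compact_closure compact_imp_bounded)
qed

lemma test_function_coordinate_mult:
  assumes "test_function \<phi>" shows "test_function (\<lambda>x. x $ k * \<phi> x)"
proof -
  have "bounded {x. x $ k * \<phi> x \<noteq> 0}"
    by (rule bounded_subset[of "{x. \<phi> x \<noteq> 0}"]) (use assms in \<open>auto simp: test_function_iff\<close>)
  then show ?thesis using assms by (simp add: test_function_iff Ck_coordinate_mult)
qed

lemma test_function_scale: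
  assumes "test_function \<phi>" shows "test_function (\<lambda>x. a * \<phi> x)"
proof -
  have "bounded {x. a * \<phi> x \<noteq> 0}"
    by (rule bounded_subset[of "{x. \<phi> x \<noteq> 0}"]) (use assms in \<open>auto simp: test_function_iff\<close>)
  moreover have "Ck k (\<lambda>x. a * \<phi> x)" for k
    using Ck_sum[of "{()}" k "\<lambda>_. \<phi>" "\<lambda>_. a"] assms by (simp add: test_function_iff)
  ultimately show ?thesis by (auto simp: test_function_iff)
qed

text \<open>
  The left inverse \<open>Q\<close> makes preimages of bounded sets bounded, which keeps the support compact.
\<close>

lemma test_function_affine:
  fixes P Q :: "real^'n^'n"
  assumes "test_function \<phi>" "Q ** P = mat 1"
  shows "test_function (\<lambda>x. \<phi> (P *v x + c))"
proof -
  have "{x. \<phi> (P *v x + c) \<noteq> 0} \<subseteq> (\<lambda>y. Q *v y) ` ((\<lambda>y. - c + y) ` {y. \<phi> y \<noteq> 0})"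
  proof
    fix x assume "x \<in> {x. \<phi> (P *v x + c) \<noteq> 0}"
    moreover have "x = Q *v (- c + (P *v x + c))"
      using assms(2) by (simp add: matrix_vector_mul_assoc)
    ultimately show "x \<in> (\<lambda>y. Q *v y) ` ((\<lambda>y. - c + y) ` {y. \<phi> y \<noteq> 0})" by blast
  qed
  moreover have "bounded ((\<lambda>y. Q *v y) ` ((\<lambda>y. - c + y) ` {y. \<phi> y \<noteq> 0}))"
    using assms(1) by (intro bounded_linear_image bounded_translation) (auto simp: test_function_iff)
  ultimately have "bounded {x. \<phi> (P *v x + c) \<noteq> 0}" by (rule bounded_subset[rotated])
  then show ?thesis using assms(1) by (simp add: test_function_iff Ck_affine)
qed

lemma test_function_bounded:
  assumes "test_function \<phi>"
  shows "\<exists>M>0. \<forall>x. \<bar>\<phi> x\<bar> \<le> M"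
proof -
  have "compact (\<phi> ` closure {x. \<phi> x \<noteq> 0})"
    using assms test_function_continuous[OF assms] unfolding test_function_def
    by (intro compact_continuous_image) (auto intro: continuous_on_subset)
  then have "bounded (\<phi> ` closure {x. \<phi> x \<noteq> 0})" by (rule compact_imp_bounded)
  then obtain M where M: "0 < M" "\<forall>y \<in> \<phi> ` closure {x. \<phi> x \<noteq> 0}. norm y \<le> M"
    unfolding bounded_pos by (elim exE conjE)
  have "\<bar>\<phi> x\<bar> \<le> M" for x
  proof (cases "\<phi> x = 0")
    case False
    then have "x \<in> closure {x. \<phi> x \<noteq> 0}"
      using subsetD[OF closure_subset, of x "{x. \<phi> x \<noteq> 0}"] by simp
    then show ?thesis using bspec[OF M(2) imageI] by simp
  qed (use M(1) in simp)
  with M(1) show ?thesis by blast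
qed

text \<open>
  The mean value theorem on the segment from \<open>x\<close> to \<open>y\<close>; of the intermediate point only its
  distance to \<open>x\<close> is retained, which is what the Lipschitz and Taylor estimates consume.
\<close>

lemma test_function_mvt:
  fixes \<phi> :: "real^'n \<Rightarrow> real"
  assumes "test_function \<phi>"
  obtains z where "norm (z - x) \<le> norm (y - x)"
    "\<phi> y - \<phi> x = (\<Sum>i\<in>UNIV. (y - x) $ i * pderiv_at i \<phi> z)"
proof -
  let ?g = "\<lambda>s::real. x + s *\<^sub>R (y - x)"
  have "(\<phi> \<circ> ?g has_derivative
      (\<lambda>h. \<Sum>i\<in>UNIV. (h *\<^sub>R (y - x)) $ i * pderiv_at i \<phi> (?g s))) (at s within {0..1})" for s
  proof -
    have "(?g has_derivative (\<lambda>h. h *\<^sub>R (y - x))) (at s within {0..1})"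
      by (auto intro!: derivative_eq_intros)
    from has_derivative_compose[OF this has_derivative_pderiv_at[OF test_function_differentiable[OF assms]]]
    show ?thesis by (simp add: o_def)
  qed
  from mvt_very_simple[of 0 1 "\<phi> \<circ> ?g", OF _ this]
  obtain s where s: "s \<in> {0..1}"
    "(\<phi> \<circ> ?g) 1 - (\<phi> \<circ> ?g) 0 = (\<Sum>i\<in>UNIV. ((1 - 0) *\<^sub>R (y - x)) $ i * pderiv_at i \<phi> (?g s))"
    by auto
  have "norm (?g s - x) \<le> 1 * norm (y - x)"
    using s(1) using mult_right_mono[of s 1 "norm (y - x)"] by simp
  then show ?thesis using s(2) that[of "?g s"] by simp
qed

lemma test_function_lipschitz:
  fixes \<phi> :: "real^'n \<Rightarrow> real"
  assumes "test_function \<phi>"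
  shows "\<exists>L>0. \<forall>x y. \<bar>\<phi> y - \<phi> x\<bar> \<le> L * norm (y - x)"
proof -
  have "\<exists>M>0. \<forall>x. \<bar>pderiv_at i \<phi> x\<bar> \<le> M" for i
    by (rule test_function_bounded[OF test_function_pderiv_at[OF assms]])
  then obtain M where M: "\<And>i. 0 < M i" "\<And>i x. \<bar>pderiv_at i \<phi> x\<bar> \<le> M i" by metis
  have "\<bar>\<phi> y - \<phi> x\<bar> \<le> (\<Sum>i\<in>UNIV. M i) * norm (y - x)" for x y
  proof -
    obtain z where "\<phi> y - \<phi> x = (\<Sum>i\<in>UNIV. (y - x) $ i * pderiv_at i \<phi> z)"
      using test_function_mvt[OF assms] by metis
    also have "\<bar>\<dots>\<bar> \<le> (\<Sum>i\<in>UNIV. \<bar>(y - x) $ i * pderiv_at i \<phi> z\<bar>)" by (rule sum_abs)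
    also have "\<dots> \<le> (\<Sum>i\<in>UNIV. norm (y - x) * M i)"
      unfolding abs_mult by (intro sum_mono mult_mono M component_le_norm_cart) auto
    finally show ?thesis by (simp add: sum_distrib_right mult.commute)
  qed
  moreover have "0 < (\<Sum>i\<in>(UNIV::'n set). M i)" by (intro sum_pos M) auto
  ultimately show ?thesis by blast
qed

text \<open>
  By the mean value theorem the remainder is a difference of two values of the gradient applied to
  \<open>y - x\<close>, and the gradient is Lipschitz.
\<close>

lemma test_function_taylor:
  fixes \<phi> :: "real^'n \<Rightarrow> real"
  assumes "test_function \<phi>"
  shows "\<exists>K>0. \<forall>x y. \<bar>\<phi> y - \<phi> x - (\<Sum>i\<in>UNIV. (y - x) $ i * pderiv_at i \<phi> x)\<bar> \<le> K * (norm (y - x))\<^sup>2"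
proof -
  have "\<exists>L>0. \<forall>x y. \<bar>pderiv_at i \<phi> y - pderiv_at i \<phi> x\<bar> \<le> L * norm (y - x)" for i
    by (rule test_function_lipschitz[OF test_function_pderiv_at[OF assms]])
  then obtain L where L: "\<And>i. 0 < L i"
    "\<And>i x y. \<bar>pderiv_at i \<phi> y - pderiv_at i \<phi> x\<bar> \<le> L i * norm (y - x)" by metis
  have "\<bar>\<phi> y - \<phi> x - (\<Sum>i\<in>UNIV. (y - x) $ i * pderiv_at i \<phi> x)\<bar> \<le> (\<Sum>i\<in>UNIV. L i) * (norm (y - x))\<^sup>2" for x y
  proof -
    obtain z where z: "norm (z - x) \<le> norm (y - x)"
      "\<phi> y - \<phi> x = (\<Sum>i\<in>UNIV. (y - x) $ i * pderiv_at i \<phi> z)"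
      using test_function_mvt[OF assms] by metis
    have "\<phi> y - \<phi> x - (\<Sum>i\<in>UNIV. (y - x) $ i * pderiv_at i \<phi> x)
        = (\<Sum>i\<in>UNIV. (y - x) $ i * (pderiv_at i \<phi> z - pderiv_at i \<phi> x))"
      by (simp add: z(2) sum_subtractf right_diff_distrib)
    also have "\<bar>\<dots>\<bar> \<le> (\<Sum>i\<in>UNIV. \<bar>(y - x) $ i * (pderiv_at i \<phi> z - pderiv_at i \<phi> x)\<bar>)" by (rule sum_abs)
    also have "\<dots> \<le> (\<Sum>i\<in>UNIV. norm (y - x) * (L i * norm (y - x)))"
      unfolding abs_mult
      by (intro sum_mono mult_mono component_le_norm_cart
          order_trans[OF L(2) mult_left_mono[OF z(1) less_imp_le[OF L(1)]]]) auto
    finally show ?thesis by (simp add: sum_distrib_right power2_eq_square mult_ac)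
  qed
  moreover have "0 < (\<Sum>i\<in>(UNIV::'n set). L i)" by (intro sum_pos L) auto
  ultimately show ?thesis by blast
qed

section \<open>Differentiating the inverse matrix\<close>

lemma has_vector_derivative_iff_difference_quotient:
  "(f has_vector_derivative D) (at x within S) \<longleftrightarrow>
     ((\<lambda>y. (1 / (y - x)) *\<^sub>R (f y - f x)) \<longlongrightarrow> D) (at x within S)"
proof -
  have "(f has_vector_derivative D) (at x within S) \<longleftrightarrow>
      ((\<lambda>y. norm (f y - f x - (y - x) *\<^sub>R D) / norm (y - x)) \<longlongrightarrow> 0) (at x within S)"
    unfolding has_vector_derivative_def has_derivative_iff_norm
    by (simp add: bounded_linear_scaleR_left)
  also have "\<dots> \<longleftrightarrow> ((\<lambda>y. norm ((1 / (y - x)) *\<^sub>R (f y - f x) - D)) \<longlongrightarrow> 0) (at x within S)"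
  proof (rule filterlim_cong[OF refl refl])
    have "norm (f y - f x - (y - x) *\<^sub>R D) / norm (y - x) = norm ((1 / (y - x)) *\<^sub>R (f y - f x) - D)"
      if "y \<noteq> x" for y
    proof -
      have "(1 / (y - x)) *\<^sub>R (f y - f x) - D = (1 / (y - x)) *\<^sub>R (f y - f x - (y - x) *\<^sub>R D)"
        using that by (simp add: scaleR_diff_right)
      then show ?thesis by simp
    qed
    then show "\<forall>\<^sub>F y in at x within S. norm (f y - f x - (y - x) *\<^sub>R D) / norm (y - x)
        = norm ((1 / (y - x)) *\<^sub>R (f y - f x) - D)"
      by (auto simp: eventually_at_filter)
  qed
  also have "\<dots> \<longleftrightarrow> ((\<lambda>y. (1 / (y - x)) *\<^sub>R (f y - f x)) \<longlongrightarrow> D) (at x within S)"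
    by (simp only: tendsto_norm_zero_iff Lim_null[symmetric])
  finally show ?thesis .
qed

lemma matrix_inv_inverse:
  assumes "invertible (A :: real^'n^'n)"
  shows "A ** matrix_inv A = mat 1" "matrix_inv A ** A = mat 1"
  using someI_ex[OF assms[unfolded invertible_def]] by (simp_all add: matrix_inv_def)

lemma bounded_bilinear_matrix_matrix_mult:
  "bounded_bilinear ((**) :: real^'n^'n \<Rightarrow> real^'n^'n \<Rightarrow> real^'n^'n)"
proof -
  have "bilinear ((**) :: real^'n^'n \<Rightarrow> real^'n^'n \<Rightarrow> real^'n^'n)"
    unfolding bilinear_def linear_iff
    by (auto simp: matrix_matrix_mult_def vec_eq_iff algebra_simps sum.distrib sum_distrib_left)
  then show ?thesis by (simp only: bilinear_conv_bounded_bilinear)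
qed

text \<open>
  Write \<open>p = \<parallel>A\<^sub>0\<^sup>-\<^sup>1\<parallel>\<close>. The resolvent identity
  \<open>A\<^sub>s\<^sup>-\<^sup>1 - A\<^sub>0\<^sup>-\<^sup>1 = A\<^sub>s\<^sup>-\<^sup>1 (A\<^sub>0 - A\<^sub>s) A\<^sub>0\<^sup>-\<^sup>1\<close> bounds the difference by \<open>\<parallel>A\<^sub>s\<^sup>-\<^sup>1\<parallel>\<close> times a small factor; once that
  factor is below \<open>1/2\<close> it also yields the a priori bound \<open>\<parallel>A\<^sub>s\<^sup>-\<^sup>1\<parallel> \<le> 2 p\<close>.
\<close>

lemma tendsto_matrix_inv:
  fixes A :: "'a \<Rightarrow> real^'n^'n"
  assumes inv: "\<forall>\<^sub>F s in F. invertible (A s)" "invertible A0" and lim: "(A \<longlongrightarrow> A0) F"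
  shows "((\<lambda>s. matrix_inv (A s)) \<longlongrightarrow> matrix_inv A0) F"
proof -
  interpret mm: bounded_bilinear "(**) :: real^'n^'n \<Rightarrow> real^'n^'n \<Rightarrow> real^'n^'n"
    by (rule bounded_bilinear_matrix_matrix_mult)
  from mm.pos_bounded obtain K where K1: "K > 0"
    and K2: "\<forall>(a :: real^'n^'n) (b :: real^'n^'n). norm (a ** b) \<le> norm a * norm b * K"
    by (elim exE conjE)
  note K = K1 K2[rule_format]
  define p where "p = norm (matrix_inv A0)"
  have "((\<lambda>s. A0 - A s) \<longlongrightarrow> A0 - A0) F" by (intro tendsto_intros lim)
  then have small: "((\<lambda>s. norm (A0 - A s)) \<longlongrightarrow> 0) F" by (simp add: tendsto_norm_zero)
  have diff: "norm (matrix_inv (A s) - matrix_inv A0) \<le> norm (matrix_inv (A s)) * (K\<^sup>2 * p * norm (A0 - A s))"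
    if "invertible (A s)" for s
  proof -
    have "matrix_inv (A s) ** (A0 - A s) ** matrix_inv A0
        = matrix_inv (A s) ** (A0 ** matrix_inv A0) - matrix_inv (A s) ** A s ** matrix_inv A0"
      by (simp add: mm.diff_right mm.diff_left matrix_mul_assoc)
    then have "matrix_inv (A s) - matrix_inv A0 = matrix_inv (A s) ** (A0 - A s) ** matrix_inv A0"
      by (simp add: matrix_inv_inverse that inv(2))
    also have "norm \<dots> \<le> norm (matrix_inv (A s) ** (A0 - A s)) * p * K" unfolding p_def by (rule K)
    also have "\<dots> \<le> norm (matrix_inv (A s)) * norm (A0 - A s) * K * p * K"
      by (intro mult_right_mono K) (use K(1) in \<open>auto simp: p_def\<close>)
    finally show ?thesis by (simp add: power2_eq_square mult_ac)
  qed
  have "((\<lambda>s. K\<^sup>2 * p * norm (A0 - A s)) \<longlongrightarrow> K\<^sup>2 * p * 0) F" by (intro tendsto_intros small)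
  then have lim0: "((\<lambda>s. K\<^sup>2 * p * norm (A0 - A s)) \<longlongrightarrow> 0) F" by simp
  then have "\<forall>\<^sub>F s in F. K\<^sup>2 * p * norm (A0 - A s) < 1 / 2" by (rule order_tendstoD) simp
  with inv(1) have "\<forall>\<^sub>F s in F. norm (matrix_inv (A s) - matrix_inv A0) \<le> 2 * p * (K\<^sup>2 * p * norm (A0 - A s))"
  proof eventually_elim
    case (elim s)
    note d = diff[OF elim(1)]
    have "norm (matrix_inv (A s)) * (K\<^sup>2 * p * norm (A0 - A s)) \<le> norm (matrix_inv (A s)) * (1 / 2)"
      using elim(2) by (intro mult_left_mono) auto
    moreover have "norm (matrix_inv (A s)) - p \<le> norm (matrix_inv (A s) - matrix_inv A0)"
      unfolding p_def by (rule norm_triangle_ineq2)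
    ultimately have "norm (matrix_inv (A s)) \<le> 2 * p" using d by simp
    then have "norm (matrix_inv (A s)) * (K\<^sup>2 * p * norm (A0 - A s)) \<le> 2 * p * (K\<^sup>2 * p * norm (A0 - A s))"
      by (rule mult_right_mono) (simp add: p_def)
    with d show ?case by linarith
  qed
  moreover have "((\<lambda>s. 2 * p * (K\<^sup>2 * p * norm (A0 - A s))) \<longlongrightarrow> 0) F"
    using tendsto_mult_right_zero[OF lim0, of "2 * p"] by simp
  ultimately have "((\<lambda>s. matrix_inv (A s) - matrix_inv A0) \<longlongrightarrow> 0) F" by (rule Lim_null_comparison)
  then show ?thesis by (simp only: Lim_null[symmetric])
qed

text \<open>
  The resolvent identity, divided by the time step, together with continuity of the inverse.
\<close>

lemma has_vector_derivative_matrix_inv: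
  fixes A :: "real \<Rightarrow> real^'n^'n"
  assumes inv: "\<And>s. s \<in> S \<Longrightarrow> invertible (A s)" and t: "t \<in> S"
    and deriv: "(A has_vector_derivative A') (at t within S)"
  shows "((\<lambda>s. matrix_inv (A s)) has_vector_derivative - (matrix_inv (A t) ** A' ** matrix_inv (A t))) (at t within S)"
proof -
  interpret mm: bounded_bilinear "(**) :: real^'n^'n \<Rightarrow> real^'n^'n \<Rightarrow> real^'n^'n"
    by (rule bounded_bilinear_matrix_matrix_mult)
  have inS: "\<forall>\<^sub>F s in at t within S. s \<in> S" by (auto simp: eventually_at_filter)
  have "((\<lambda>s. matrix_inv (A s)) \<longlongrightarrow> matrix_inv (A t)) (at t within S)"
  proof (rule tendsto_matrix_inv)
    show "\<forall>\<^sub>F s in at t within S. invertible (A s)" using inS by eventually_elim (rule inv)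
    show "(A \<longlongrightarrow> A t) (at t within S)"
      using has_vector_derivative_continuous[OF deriv] by (simp add: continuous_within)
  qed (rule inv[OF t])
  then have "((\<lambda>s. - (matrix_inv (A s) ** ((1 / (s - t)) *\<^sub>R (A s - A t)) ** matrix_inv (A t)))
      \<longlongrightarrow> - (matrix_inv (A t) ** A' ** matrix_inv (A t))) (at t within S)"
    by (intro tendsto_minus mm.tendsto tendsto_const
        deriv[unfolded has_vector_derivative_iff_difference_quotient])
  moreover have "\<forall>\<^sub>F s in at t within S.
      - (matrix_inv (A s) ** ((1 / (s - t)) *\<^sub>R (A s - A t)) ** matrix_inv (A t))
      = (1 / (s - t)) *\<^sub>R (matrix_inv (A s) - matrix_inv (A t))"
    using inS
  proof eventually_elim
    case (elim s)
    have "matrix_inv (A s) ** (A s - A t) ** matrix_inv (A t)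
        = matrix_inv (A s) ** A s ** matrix_inv (A t) - matrix_inv (A s) ** (A t ** matrix_inv (A t))"
      by (simp add: mm.diff_right mm.diff_left matrix_mul_assoc)
    then have "matrix_inv (A s) ** (A s - A t) ** matrix_inv (A t) = matrix_inv (A t) - matrix_inv (A s)"
      by (simp add: matrix_inv_inverse inv[OF elim] inv[OF t])
    then show ?case
      by (simp add: mm.scaleR_right mm.scaleR_left scaleR_minus_right[symmetric] del: scaleR_minus_right)
  qed
  ultimately show ?thesis
    unfolding has_vector_derivative_iff_difference_quotient by (rule Lim_transform_eventually)
qed

lemma pos_def_factor_invertible:
  fixes A C :: "real^'n^'n"
  assumes "pos_def C" "A ** transpose A = C"
  shows "invertible A"
proof -
  have "x = 0" if "transpose A *v x = 0" for x
  proof (rule ccontr)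
    assume "x \<noteq> 0"
    then have "0 < x \<bullet> (C *v x)" using assms(1) by (simp add: pos_def_def)
    moreover have "C *v x = A *v (transpose A *v x)"
      by (simp only: assms(2)[symmetric] matrix_vector_mul_assoc)
    ultimately show False using that by (simp del: transpose_matrix_vector)
  qed
  then have "\<exists>D. D ** transpose A = mat 1"
    by (subst matrix_left_invertible_ker) blast
  then show ?thesis by (simp only: left_invertible_transpose invertible_right_inverse)
qed

section \<open>Moments\<close>

text \<open>
  The weight \<open>(1 + |x|)\<^sup>2\<close> is used as a common majorant for everything that second moments control.
\<close>

lemma P2pos_integrable:
  fixes f :: "real^'n \<Rightarrow> 'b::{banach, second_countable_topology}"
  assumes \<mu>: "\<mu> \<in> P2pos" and f: "continuous_on UNIV f" "\<And>x. norm (f x) \<le> K * (1 + norm x)\<^sup>2"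
  shows "integrable \<mu> f"
proof -
  interpret prob_space \<mu> using \<mu> by (simp add: P2pos_def)
  have sets: "sets \<mu> = sets borel" using \<mu> by (simp add: P2pos_def)
  have "integrable \<mu> (\<lambda>x. \<bar>K\<bar> * (2 + 2 * (norm x)\<^sup>2))"
    using \<mu> by (auto simp: P2pos_def)
  then show ?thesis
  proof (rule Bochner_Integration.integrable_bound)
    show "f \<in> borel_measurable \<mu>"
      using borel_measurable_continuous_onI[OF f(1)] sets by (simp cong: measurable_cong_sets)
    have "norm (f x) \<le> norm (\<bar>K\<bar> * (2 + 2 * (norm x)\<^sup>2))" for x
    proof -
      have "(1 + norm x)\<^sup>2 \<le> 2 + 2 * (norm x)\<^sup>2"
        using zero_le_power2[of "1 - norm x"] by (simp add: power2_eq_square algebra_simps)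
      then have "\<bar>K\<bar> * (1 + norm x)\<^sup>2 \<le> \<bar>K\<bar> * (2 + 2 * (norm x)\<^sup>2)" by (rule mult_left_mono) simp
      moreover have "K * (1 + norm x)\<^sup>2 \<le> \<bar>K\<bar> * (1 + norm x)\<^sup>2" by (intro mult_right_mono) auto
      ultimately have "norm (f x) \<le> \<bar>K\<bar> * (2 + 2 * (norm x)\<^sup>2)" using f(2)[of x] by linarith
      then show ?thesis unfolding real_norm_def by linarith
    qed
    then show "AE x in \<mu>. norm (f x) \<le> norm (\<bar>K\<bar> * (2 + 2 * (norm x)\<^sup>2))" by simp
  qed
qed

lemma one_le_weight: "1 \<le> (1 + norm x)\<^sup>2"
  by (rule one_le_power) simp

lemma one_plus_norm_le_weight: "1 + norm x \<le> (1 + norm x)\<^sup>2"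
  by (rule self_le_power) auto

lemma P2pos_integrable_bounded:
  fixes f :: "real^'n \<Rightarrow> 'b::{banach, second_countable_topology}"
  assumes \<mu>: "\<mu> \<in> P2pos" and f: "continuous_on UNIV f" "\<And>x. norm (f x) \<le> K"
  shows "integrable \<mu> f"
proof (rule P2pos_integrable[OF \<mu> f(1)])
  fix x :: "real^'n"
  have "0 \<le> K" using f(2)[of 0] norm_ge_zero order_trans by blast
  then have "K * 1 \<le> K * (1 + norm x)\<^sup>2" by (intro mult_left_mono one_le_weight)
  with f(2)[of x] show "norm (f x) \<le> K * (1 + norm x)\<^sup>2" by linarith
qed

lemma P2pos_integrable_id:
  fixes \<mu> :: "(real^'n) measure"
  assumes \<mu>: "\<mu> \<in> P2pos"
  shows "integrable \<mu> (\<lambda>x. x)"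
proof (rule P2pos_integrable[OF \<mu>])
  fix x :: "real^'n"
  show "norm x \<le> 1 * (1 + norm x)\<^sup>2" using one_plus_norm_le_weight[of x] by simp
qed (intro continuous_intros)

lemma mean_nth:
  fixes \<mu> :: "(real^'n) measure"
  assumes \<mu>: "\<mu> \<in> P2pos" shows "mean \<mu> $ k = (\<integral>x. x $ k \<partial>\<mu>)"
  unfolding mean_def
  by (rule integral_bounded_linear[OF bounded_linear_vec_nth P2pos_integrable_id[OF \<mu>], symmetric])

lemma test_function_integrable:
  assumes "\<mu> \<in> P2pos" "test_function \<phi>" shows "integrable \<mu> \<phi>"
  using P2pos_integrable_bounded[OF assms(1) test_function_continuous[OF assms(2)]]
    test_function_bounded[OF assms(2)] by (metis real_norm_def)

lemma norm_diff_square_le: "(norm (x - m :: real^'n))\<^sup>2 \<le> (1 + norm m)\<^sup>2 * (1 + norm x)\<^sup>2"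
proof -
  have "norm (x - m) \<le> norm x + norm m" by (rule norm_triangle_ineq4)
  also have "\<dots> \<le> (1 + norm m) * (1 + norm x)" by (simp add: algebra_simps)
  finally have "norm (x - m) \<le> (1 + norm m) * (1 + norm x)" .
  then show ?thesis unfolding power_mult_distrib[symmetric] by (rule power_mono) simp
qed

lemma continuous_outer: "continuous_on UNIV (\<lambda>x. outer (x - m) (x - m :: real^'n))"
  unfolding outer_def by (intro continuous_intros continuous_on_vec_lambda)

lemma trace_cov:
  fixes \<mu> :: "(real^'n) measure"
  assumes \<mu>: "\<mu> \<in> P2pos"
  shows "(\<Sum>i\<in>UNIV. cov \<mu> $ i $ i) = (\<integral>x. (norm (x - mean \<mu>))\<^sup>2 \<partial>\<mu>)"
proof -
  define T :: "real^'n^'n \<Rightarrow> real" where "T = (\<lambda>M. \<Sum>i\<in>UNIV. M $ i $ i)"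
  have T: "bounded_linear T" unfolding T_def
    by (intro bounded_linear_sum bounded_linear_compose[OF bounded_linear_vec_nth bounded_linear_vec_nth])
  have "norm (outer y y) \<le> (norm y)\<^sup>2" for y :: "real^'n"
  proof -
    have "outer y y = (\<chi> i. (y $ i) *\<^sub>R y)" by (simp add: outer_def vec_eq_iff)
    then have "norm (outer y y) = L2_set (\<lambda>i. norm ((y $ i) *\<^sub>R y)) UNIV"
      unfolding norm_vec_def[of "outer y y"] by simp
    also have "\<dots> = L2_set (\<lambda>i. \<bar>y $ i\<bar>) UNIV * norm y" by (simp add: L2_set_left_distrib)
    also have "\<dots> = norm y * norm y" by (simp add: norm_vec_def)
    finally show ?thesis by (simp add: power2_eq_square)
  qed
  then have "integrable \<mu> (\<lambda>x. outer (x - mean \<mu>) (x - mean \<mu>))"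
    using norm_diff_square_le order_trans
    by (intro P2pos_integrable[OF \<mu> continuous_outer]) blast
  from integral_bounded_linear[OF T this] have "T (cov \<mu>) = (\<integral>x. T (outer (x - mean \<mu>) (x - mean \<mu>)) \<partial>\<mu>)"
    by (simp add: cov_def)
  also have "\<dots> = (\<integral>x. (norm (x - mean \<mu>))\<^sup>2 \<partial>\<mu>)"
    by (simp add: T_def outer_def power2_norm_eq_inner inner_vec_def)
  finally show ?thesis by (simp add: T_def)
qed

text \<open>
  The covariance controls second moments only relative to the mean.
\<close>

lemma weight_integral_le:
  fixes \<mu> :: "(real^'n) measure"
  assumes \<mu>: "\<mu> \<in> P2pos"
  shows "(\<integral>x. (1 + norm x)\<^sup>2 \<partial>\<mu>) \<le> 2 + 4 * (norm (mean \<mu>))\<^sup>2 + 4 * (\<Sum>i\<in>UNIV. cov \<mu> $ i $ i)"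
proof -
  interpret prob_space \<mu> using \<mu> by (simp add: P2pos_def)
  define m where "m = mean \<mu>"
  have int: "integrable \<mu> (\<lambda>x. (norm (x - m))\<^sup>2)"
    by (rule P2pos_integrable[OF \<mu>]) (use norm_diff_square_le in \<open>auto intro!: continuous_intros\<close>)
  have "(\<integral>x. (1 + norm x)\<^sup>2 \<partial>\<mu>) \<le> (\<integral>x. 2 + 4 * (norm m)\<^sup>2 + 4 * (norm (x - m))\<^sup>2 \<partial>\<mu>)"
  proof (rule integral_mono)
    show "integrable \<mu> (\<lambda>x. (1 + norm x)\<^sup>2)"
      by (rule P2pos_integrable[OF \<mu>, where K = 1]) (auto intro!: continuous_intros)
    show "integrable \<mu> (\<lambda>x. 2 + 4 * (norm m)\<^sup>2 + 4 * (norm (x - m))\<^sup>2)" using int by simp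
    fix x
    have "norm x \<le> norm m + norm (x - m)" using norm_triangle_ineq[of m "x - m"] by simp
    then have "(norm x)\<^sup>2 \<le> (norm m + norm (x - m))\<^sup>2" by (rule power_mono) simp
    also have "\<dots> \<le> 2 * (norm m)\<^sup>2 + 2 * (norm (x - m))\<^sup>2"
      using zero_le_power2[of "norm m - norm (x - m)"] by (simp add: power2_eq_square algebra_simps)
    finally show "(1 + norm x)\<^sup>2 \<le> 2 + 4 * (norm m)\<^sup>2 + 4 * (norm (x - m))\<^sup>2"
      using zero_le_power2[of "1 - norm x"] by (simp add: power2_eq_square algebra_simps)
  qed
  also have "\<dots> = 2 + 4 * (norm m)\<^sup>2 + 4 * (\<integral>x. (norm (x - m))\<^sup>2 \<partial>\<mu>)"
    using int by (simp add: prob_space)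
  finally show ?thesis by (simp add: trace_cov[OF \<mu>] m_def)
qed

section \<open>The generator of the Fokker-Planck equation\<close>

text \<open>
  The operator \<open>\<psi> \<mapsto> tr (C D\<^sup>2\<psi>) - (C b) \<bullet> \<nabla>\<psi>\<close>, the formal adjoint of \<open>\<rho> \<mapsto> \<nabla> \<bullet> (C (\<nabla>\<rho> + \<rho> b))\<close>.
\<close>

definition fp_generator ::
    "real^'n^'n \<Rightarrow> (real^'n \<Rightarrow> real^'n) \<Rightarrow> (real^'n \<Rightarrow> real) \<Rightarrow> real^'n \<Rightarrow> real" where
  "fp_generator C b \<psi> x =
     (\<Sum>i\<in>UNIV. \<Sum>j\<in>UNIV. C $ i $ j * (pderiv_at j (pderiv_at i \<psi>) x - b x $ j * pderiv_at i \<psi> x))"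

lemma affine_field_growth:
  fixes M :: "real^'n^'n"
  shows "\<exists>\<beta>>0. \<forall>x. norm (M *v (x - x0)) \<le> \<beta> * (1 + norm x)"
proof -
  from bounded_linear.pos_bounded[OF matrix_vector_mul_bounded_linear[of M]]
  obtain K where K: "K > 0" "\<forall>x. norm (M *v x) \<le> norm x * K" by (elim exE conjE)
  have "norm (M *v (x - x0)) \<le> K * (1 + norm x0) * (1 + norm x)" for x
  proof -
    have "norm (x - x0) \<le> norm x + norm x0" by (rule norm_triangle_ineq4)
    also have "\<dots> \<le> (1 + norm x0) * (1 + norm x)" by (simp add: algebra_simps)
    finally have "norm (x - x0) * K \<le> (1 + norm x0) * (1 + norm x) * K"
      using K(1) by (intro mult_right_mono) auto
    with K(2)[rule_format, of "x - x0"] show ?thesis by (simp add: mult_ac)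
  qed
  moreover have "0 < K * (1 + norm x0)" using K(1) by (simp add: add_pos_nonneg)
  ultimately show ?thesis by blast
qed

lemma continuous_affine_field: "continuous_on UNIV (\<lambda>x. M *v (x - x0 :: real^'n) :: real^'n)"
  by (rule bounded_linear.continuous_on[OF matrix_vector_mul_bounded_linear]) (intro continuous_intros)

lemma integrable_affine_field:
  fixes M :: "real^'n^'n"
  assumes \<mu>: "\<mu> \<in> P2pos"
  shows "integrable \<mu> (\<lambda>x. M *v (x - x0))"
proof -
  from affine_field_growth[of M x0] obtain \<beta> where \<beta>: "\<beta> > 0" "\<forall>x. norm (M *v (x - x0)) \<le> \<beta> * (1 + norm x)" by (elim exE conjE)
  show ?thesis
  proof (rule P2pos_integrable[OF \<mu>])
    show "continuous_on UNIV (\<lambda>x. M *v (x - x0))" by (rule continuous_affine_field)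
    fix x :: "real^'n"
    have "\<beta> * (1 + norm x) \<le> \<beta> * (1 + norm x)\<^sup>2"
      using \<beta>(1) one_plus_norm_le_weight[of x] by (intro mult_left_mono) auto
    with \<beta>(2)[rule_format, of x] show "norm (M *v (x - x0)) \<le> \<beta> * (1 + norm x)\<^sup>2" by linarith
  qed
qed

lemma integrable_test_function_affine_field:
  fixes M :: "real^'n^'n"
  assumes \<mu>: "\<mu> \<in> P2pos" and \<phi>: "test_function \<phi>"
  shows "integrable \<mu> (\<lambda>x. \<phi> x *\<^sub>R (M *v (x - x0)))"
proof -
  from affine_field_growth[of M x0] obtain \<beta> where \<beta>: "\<beta> > 0" "\<forall>x. norm (M *v (x - x0)) \<le> \<beta> * (1 + norm x)" by (elim exE conjE)
  from test_function_bounded[OF \<phi>] obtain K where K: "K > 0" "\<forall>x. \<bar>\<phi> x\<bar> \<le> K" by (elim exE conjE)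
  show ?thesis
  proof (rule P2pos_integrable[OF \<mu>])
    show "continuous_on UNIV (\<lambda>x. \<phi> x *\<^sub>R (M *v (x - x0)))"
      by (intro continuous_on_scaleR test_function_continuous[OF \<phi>] continuous_affine_field)
    fix x :: "real^'n"
    have "\<beta> * (1 + norm x) \<le> \<beta> * (1 + norm x)\<^sup>2"
      using \<beta>(1) one_plus_norm_le_weight[of x] by (intro mult_left_mono) auto
    with \<beta>(2)[rule_format, of x] have "norm (M *v (x - x0)) \<le> \<beta> * (1 + norm x)\<^sup>2" by linarith
    then have "\<bar>\<phi> x\<bar> * norm (M *v (x - x0)) \<le> K * (\<beta> * (1 + norm x)\<^sup>2)"
      using K by (intro mult_mono) auto
    then show "norm (\<phi> x *\<^sub>R (M *v (x - x0))) \<le> (K * \<beta>) * (1 + norm x)\<^sup>2" by simp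
  qed
qed

lemma integrable_fp_term:
  fixes M :: "real^'n^'n"
  assumes \<mu>: "\<mu> \<in> P2pos" and \<psi>: "test_function \<psi>"
  shows "integrable \<mu> (\<lambda>x. (M *v (x - x0)) $ j * \<psi> x)"
proof -
  have "integrable \<mu> (\<lambda>x. (\<psi> x *\<^sub>R (M *v (x - x0))) $ j)"
    by (intro integrable_bounded_linear[OF bounded_linear_vec_nth]
        integrable_test_function_affine_field assms)
  then show ?thesis by (simp add: mult.commute)
qed

text \<open>
  The derivatives that the distributional divergence and gradient move onto \<open>\<psi>\<close> are collected
  under one integral, which is the form in which the estimates and the change of variables apply.
\<close>

lemma fokker_planck_rhs:
  fixes M :: "real^'n^'n"
  assumes \<mu>: "\<mu> \<in> P2pos" and \<psi>: "test_function \<psi>"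
  shows "ddiv (\<lambda>\<phi>. C *v (dgrad (meas \<mu>) \<phi> + meas_field (\<lambda>x. M *v (x - x0)) \<mu> \<phi>)) \<psi>
       = (\<integral>x. fp_generator C (\<lambda>x. M *v (x - x0)) \<psi> x \<partial>\<mu>)"
proof -
  have field: "meas_field (\<lambda>x. M *v (x - x0)) \<mu> \<phi> $ j = (\<integral>x. (M *v (x - x0)) $ j * \<phi> x \<partial>\<mu>)"
    if "test_function \<phi>" for \<phi> j
    unfolding meas_field_def
    by (subst integral_bounded_linear[OF bounded_linear_vec_nth
          integrable_test_function_affine_field[OF \<mu> that], symmetric]) (simp add: mult.commute)
  have neg: "- (c * (f - a)) = c * (a - f)" for c a f :: real by (simp add: algebra_simps)
  note tf = test_function_pderiv_at[OF \<psi>] test_function_pderiv_at[OF test_function_pderiv_at[OF \<psi>]]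
  note int = test_function_integrable[OF \<mu> tf(2)] integrable_fp_term[OF \<mu> tf(1)]
  have "(\<integral>x. fp_generator C (\<lambda>x. M *v (x - x0)) \<psi> x \<partial>\<mu>)
      = (\<Sum>i\<in>UNIV. \<Sum>j\<in>UNIV. C $ i $ j * ((\<integral>x. pderiv_at j (pderiv_at i \<psi>) x \<partial>\<mu>)
          - (\<integral>x. (M *v (x - x0)) $ j * pderiv_at i \<psi> x \<partial>\<mu>)))"
    unfolding fp_generator_def
    by (simp add: Bochner_Integration.integral_sum int Bochner_Integration.integral_diff)
  also have "\<dots> = ddiv (\<lambda>\<phi>. C *v (dgrad (meas \<mu>) \<phi> + meas_field (\<lambda>x. M *v (x - x0)) \<mu> \<phi>)) \<psi>"
    unfolding ddiv_def matrix_vector_mult_def[of C] dgrad_def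
    by (simp add: field tf meas_def sum_negf[symmetric] neg)
  finally show ?thesis by simp
qed

lemma integrable_fp_generator:
  fixes M :: "real^'n^'n"
  assumes \<mu>: "\<mu> \<in> P2pos" and \<psi>: "test_function \<psi>"
  shows "integrable \<mu> (fp_generator C (\<lambda>x. M *v (x - x0)) \<psi>)"
  unfolding fp_generator_def
  by (intro Bochner_Integration.integrable_sum Bochner_Integration.integrable_mult_right
      Bochner_Integration.integrable_diff integrable_fp_term[OF \<mu>] test_function_integrable[OF \<mu>]
      test_function_pderiv_at \<psi>)

section \<open>Cutoffs of the coordinate functions\<close>

lemma pderiv_at_lincomb:
  assumes "f differentiable (at x)" "g differentiable (at x)"
  shows "pderiv_at i (\<lambda>x. a * f x + c * g x) x = a * pderiv_at i f x + c * pderiv_at i g x"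
proof -
  have "((\<lambda>x. a * f x + c * g x) has_derivative
      (\<lambda>h. a * (\<Sum>i\<in>UNIV. h $ i * pderiv_at i f x) + c * (\<Sum>i\<in>UNIV. h $ i * pderiv_at i g x))) (at x)"
    by (intro has_derivative_add has_derivative_mult_right has_derivative_pderiv_at assms)
  from pderiv_at_eq[OF this] show ?thesis
    by (simp add: axis_def if_distrib[of "\<lambda>z. z * _"] cong: if_cong)
qed

lemma mat_mult_vec: "mat e *v (x::real^'n) = e *\<^sub>R x"
  by (simp add: matrix_vector_mult_def mat_def vec_eq_iff if_distrib[of "\<lambda>z. z * _"] cong: if_cong)

lemma mat_nth: "mat e $ i $ j = (if i = j then e else 0)"
  by (simp add: mat_def)

lemma test_function_dilate:
  fixes \<kappa> :: "real^'n \<Rightarrow> real"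
  assumes "test_function \<kappa>" "e \<noteq> 0"
  shows "test_function (\<lambda>x. \<kappa> (e *\<^sub>R x))"
proof -
  have "mat (1 / e) ** mat e = (mat 1 :: real^'n^'n)"
    using assms(2) by (auto simp: matrix_matrix_mult_def mat_def vec_eq_iff
        if_distrib[of "\<lambda>z. z * _"] if_distrib[of "\<lambda>z. _ * z"] cong: if_cong)
  from test_function_affine[OF assms(1) this, of 0] show ?thesis by (simp add: mat_mult_vec)
qed

lemma pderiv_at_dilate:
  fixes \<kappa> :: "real^'n \<Rightarrow> real"
  assumes "test_function \<kappa>"
  shows "pderiv_at i (\<lambda>x. \<kappa> (e *\<^sub>R x)) x = e * pderiv_at i \<kappa> (e *\<^sub>R x)"
  using pderiv_at_affine[OF test_function_differentiable[OF assms], where P = "mat e" and c = 0 and i = i and x = x]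
  by (simp add: mat_mult_vec mat_nth if_distrib[of "\<lambda>z. z * _"] cong: if_cong)

lemma bounded_family:
  assumes "\<And>i::'i::finite. \<exists>M>0. \<forall>x. \<bar>f i x :: real\<bar> \<le> M"
  shows "\<exists>M>0. \<forall>i x. \<bar>f i x\<bar> \<le> M"
proof -
  from assms obtain M where M: "\<And>i. M i > 0" "\<And>i x. \<bar>f i x\<bar> \<le> M i" by metis
  have "M i \<le> (\<Sum>i\<in>UNIV. M i)" for i
    using M(1) by (intro member_le_sum) (auto intro: less_imp_le)
  then have "\<bar>f i x\<bar> \<le> (\<Sum>i\<in>UNIV. M i)" for i x using M(2) order_trans by blast
  moreover have "0 < (\<Sum>i\<in>(UNIV::'i set). M i)" by (intro sum_pos M) auto
  ultimately show ?thesis by blast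
qed

text \<open>
  The witness is \<open>\<psi> x = x\<^sub>k \<kappa> (e x)\<close>. Every term in which a derivative falls on the dilated cutoff
  gains a factor \<open>e\<close>, and \<open>\<kappa> (e x) - 1\<close> is at most \<open>e |x|\<close> times the Lipschitz constant of \<open>\<kappa>\<close>. The value
  at the origin is thus all that has to be prescribed about \<open>\<kappa>\<close>.
\<close>

lemma cutoff_coordinate:
  fixes \<kappa> :: "real^'n \<Rightarrow> real"
  assumes \<kappa>: "test_function \<kappa>" and \<kappa>0: "\<kappa> 0 = 1"
  shows "\<exists>K>0. \<forall>e k. 0 < e \<and> e \<le> 1 \<longrightarrow> (\<exists>\<psi> :: real^'n \<Rightarrow> real. test_function \<psi>
    \<and> (\<forall>x. \<bar>\<psi> x - x $ k\<bar> \<le> e * K * (1 + norm x)\<^sup>2)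
    \<and> (\<forall>i x. \<bar>pderiv_at i \<psi> x - (if i = k then 1 else 0)\<bar> \<le> e * K * (1 + norm x))
    \<and> (\<forall>i j x. \<bar>pderiv_at j (pderiv_at i \<psi>) x\<bar> \<le> e * K * (1 + norm x)))"
proof -
  note \<kappa>1 = test_function_pderiv_at[OF \<kappa>]
  note \<kappa>2 = test_function_pderiv_at[OF \<kappa>1]
  from test_function_lipschitz[OF \<kappa>] obtain L
    where L: "L > 0" "\<forall>x y. \<bar>\<kappa> y - \<kappa> x\<bar> \<le> L * norm (y - x)" by (elim exE conjE)
  from bounded_family[of "\<lambda>i. pderiv_at i \<kappa>", OF test_function_bounded[OF \<kappa>1]]
  obtain M1 where M1: "M1 > 0" "\<forall>i x. \<bar>pderiv_at i \<kappa> x\<bar> \<le> M1" by (elim exE conjE)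
  from bounded_family[of "\<lambda>(j,i). pderiv_at j (pderiv_at i \<kappa>)"] test_function_bounded[OF \<kappa>2]
  obtain M2 where M2: "M2 > 0" "\<forall>j i x. \<bar>pderiv_at j (pderiv_at i \<kappa>) x\<bar> \<le> M2" by auto
  define K where "K = L + 2 * M1 + M2"
  have "\<exists>\<psi> :: real^'n \<Rightarrow> real. test_function \<psi>
    \<and> (\<forall>x. \<bar>\<psi> x - x $ k\<bar> \<le> e * K * (1 + norm x)\<^sup>2)
    \<and> (\<forall>i x. \<bar>pderiv_at i \<psi> x - (if i = k then 1 else 0)\<bar> \<le> e * K * (1 + norm x))
    \<and> (\<forall>i j x. \<bar>pderiv_at j (pderiv_at i \<psi>) x\<bar> \<le> e * K * (1 + norm x))"
    if e: "0 < e" "e \<le> 1" for e k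
  proof (intro exI conjI allI)
    let ?\<psi> = "\<lambda>x. x $ k * \<kappa> (e *\<^sub>R x)"
    let ?d = "\<lambda>i. if i = k then 1 else (0::real)"
    have e0: "e \<noteq> 0" using e by simp
    show "test_function ?\<psi>"
      by (rule test_function_coordinate_mult[OF test_function_dilate[OF \<kappa> e0]])
    have p1: "pderiv_at i ?\<psi> = (\<lambda>x. ?d i * \<kappa> (e *\<^sub>R x) + e * (x $ k * pderiv_at i \<kappa> (e *\<^sub>R x)))" for i
      by (rule ext, subst pderiv_at_coordinate_mult[OF test_function_differentiable[OF test_function_dilate[OF \<kappa> e0]]])
        (simp add: pderiv_at_dilate[OF \<kappa>])
    have p2: "pderiv_at j (pderiv_at i ?\<psi>) x = ?d i * (e * pderiv_at j \<kappa> (e *\<^sub>R x))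
        + e * (?d j * pderiv_at i \<kappa> (e *\<^sub>R x) + x $ k * (e * pderiv_at j (pderiv_at i \<kappa>) (e *\<^sub>R x)))" for i j x
    proof -
      note t1 = test_function_dilate[OF \<kappa>1 e0]
      show ?thesis unfolding p1
        by (subst pderiv_at_lincomb[OF test_function_differentiable[OF test_function_dilate[OF \<kappa> e0]]
              test_function_differentiable[OF test_function_coordinate_mult[OF t1]]],
            subst pderiv_at_coordinate_mult[OF test_function_differentiable[OF t1]])
          (simp add: pderiv_at_dilate[OF \<kappa>] pderiv_at_dilate[OF \<kappa>1])
    qed
    have one: "\<bar>\<kappa> (e *\<^sub>R x) - 1\<bar> \<le> e * L * norm x" for x :: "real^'n"
      using L(2)[rule_format, of "e *\<^sub>R x" 0] \<kappa>0 e by (simp add: mult_ac)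
    have xk: "\<bar>x $ k\<bar> \<le> norm x" for x :: "real^'n" by (rule component_le_norm_cart)
    show "\<bar>?\<psi> x - x $ k\<bar> \<le> e * K * (1 + norm x)\<^sup>2" for x
    proof -
      have "\<bar>?\<psi> x - x $ k\<bar> = \<bar>x $ k\<bar> * \<bar>\<kappa> (e *\<^sub>R x) - 1\<bar>"
        by (simp add: abs_mult[symmetric] algebra_simps)
      also have "\<dots> \<le> norm x * (e * L * norm x)" by (intro mult_mono xk one) auto
      also have "\<dots> = e * L * (norm x)\<^sup>2" by (simp add: power2_eq_square)
      also have "\<dots> \<le> e * K * (1 + norm x)\<^sup>2"
        using e L M1 M2 by (intro mult_mono power_mono) (auto simp: K_def)
      finally show ?thesis .
    qed
    show "\<bar>pderiv_at i ?\<psi> x - ?d i\<bar> \<le> e * K * (1 + norm x)" for i x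
    proof -
      have "\<bar>pderiv_at i ?\<psi> x - ?d i\<bar> \<le> \<bar>\<kappa> (e *\<^sub>R x) - 1\<bar> + \<bar>e * (x $ k * pderiv_at i \<kappa> (e *\<^sub>R x))\<bar>"
        unfolding p1 by auto
      also have "\<bar>e * (x $ k * pderiv_at i \<kappa> (e *\<^sub>R x))\<bar> \<le> e * (norm x * M1)"
        using e M1 xk unfolding abs_mult by (intro mult_mono) auto
      also have "\<bar>\<kappa> (e *\<^sub>R x) - 1\<bar> + e * (norm x * M1) \<le> e * L * norm x + e * (norm x * M1)"
        using one[of x] by simp
      also have "\<dots> = e * (L + M1) * norm x" by (simp add: algebra_simps)
      also have "\<dots> \<le> e * K * (1 + norm x)"
        using e L M1 M2 by (intro mult_mono) (auto simp: K_def)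
      finally show ?thesis by simp
    qed
    show "\<bar>pderiv_at j (pderiv_at i ?\<psi>) x\<bar> \<le> e * K * (1 + norm x)" for i j x
    proof -
      have a: "\<bar>?d i * (e * pderiv_at j \<kappa> (e *\<^sub>R x))\<bar> \<le> e * M1"
        using e M1 by (auto simp: abs_mult)
      have b: "\<bar>e * (?d j * pderiv_at i \<kappa> (e *\<^sub>R x))\<bar> \<le> e * M1"
        using e M1 by (auto simp: abs_mult)
      have "\<bar>e * (x $ k * (e * pderiv_at j (pderiv_at i \<kappa>) (e *\<^sub>R x)))\<bar> \<le> e * (norm x * (1 * M2))"
        using e M2 xk unfolding abs_mult by (intro mult_mono) auto
      with a b have "\<bar>pderiv_at j (pderiv_at i ?\<psi>) x\<bar> \<le> e * M1 + e * M1 + e * (norm x * (1 * M2))"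
        unfolding p2 distrib_left by linarith
      also have "\<dots> = e * (2 * M1 * 1 + M2 * norm x)" by (simp add: algebra_simps)
      also have "\<dots> \<le> e * (K * (1 + norm x))"
      proof (rule mult_left_mono)
        have "2 * M1 * 1 + M2 * norm x \<le> K * 1 + K * norm x"
          using L M1 M2 by (intro add_mono mult_mono) (auto simp: K_def)
        then show "2 * M1 * 1 + M2 * norm x \<le> K * (1 + norm x)" by (simp add: algebra_simps)
      qed (use e in simp)
      finally show ?thesis by simp
    qed
  qed
  moreover have "K > 0" using L M1 M2 by (simp add: K_def)
  ultimately show ?thesis by blast
qed

section \<open>The equation for the mean\<close>

text \<open>
  The facts about the curve from which the equation for the mean follows: the weak equation for the
  affine field \<open>M (x - x\<^sub>0)\<close> and continuity of the covariance in time. Continuity of the mean and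
  bounds on the second moment are consequences.
\<close>

locale affine_fokker_planck =
  fixes M :: "real^'n^'n" and x0 :: "real^'n" and \<rho> :: "real \<Rightarrow> (real^'n) measure" and I :: "real set"
  assumes interval: "is_interval I"
    and P2: "t \<in> I \<Longrightarrow> \<rho> t \<in> P2pos"
    and cov_cont: "continuous_on I (\<lambda>s. cov (\<rho> s))"
    and weak: "test_function \<psi> \<Longrightarrow> t \<in> I \<Longrightarrow>
      ((\<lambda>s. meas (\<rho> s) \<psi>) has_real_derivative
         (\<integral>x. fp_generator (cov (\<rho> t)) (\<lambda>x. M *v (x - x0)) \<psi> x \<partial>\<rho> t)) (at t within I)"
begin

abbreviation "weight t \<equiv> (\<integral>x. (1 + norm x)\<^sup>2 \<partial>\<rho> t)"

lemma weight_integrable: "t \<in> I \<Longrightarrow> integrable (\<rho> t) (\<lambda>x. (1 + norm x)\<^sup>2)"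
  by (rule P2pos_integrable[OF P2, where K = 1]) (auto intro!: continuous_intros)

lemma prob: "t \<in> I \<Longrightarrow> prob_space (\<rho> t)"
  using P2 by (simp add: P2pos_def)

lemma weight_ge_1:
  assumes "t \<in> I" shows "1 \<le> weight t"
proof -
  interpret prob_space "\<rho> t" by (rule prob[OF assms])
  have "(\<integral>x. 1 \<partial>\<rho> t) \<le> weight t"
    by (rule integral_mono[OF _ weight_integrable[OF assms]]) (simp_all add: one_le_weight)
  then show ?thesis by (simp add: prob_space)
qed

lemma norm_mean_le_weight:
  assumes "t \<in> I" shows "norm (mean (\<rho> t)) \<le> weight t"
proof -
  have "norm (mean (\<rho> t)) \<le> (\<integral>x. norm x \<partial>\<rho> t)" unfolding mean_def by (rule integral_norm_bound)
  also have "\<dots> \<le> weight t"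
  proof (rule integral_mono[OF _ weight_integrable[OF assms]])
    show "integrable (\<rho> t) norm" using P2pos_integrable_id[OF P2[OF assms]] by (rule integrable_norm)
    show "norm x \<le> (1 + norm x)\<^sup>2" for x :: "real^'n" using one_plus_norm_le_weight[of x] by linarith
  qed
  finally show ?thesis .
qed

text \<open>
  A dilated cutoff \<open>\<psi>\<close> has \<open>\<integral> \<psi> d\<rho>\<^sub>t \<ge> 3/4\<close>, so \<open>\<integral> \<psi> d\<rho>\<^sub>s > 1/2\<close> for \<open>s\<close> near \<open>t\<close>. If the support of
  \<open>\<psi>\<close> lies in the ball of radius \<open>r\<close> and the mean \<open>m\<close> of \<open>\<rho>\<^sub>s\<close> is at distance \<open>d\<close> from this ball,
  then \<open>d\<^sup>2 \<psi> x \<le> max |\<psi>| |x - m|\<^sup>2\<close> for all \<open>x\<close>, and integration bounds \<open>d\<^sup>2\<close> by a multiple of the trace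
  of the covariance, which is continuous in time. Hence the mean, and with it the second moment,
  stays bounded.
\<close>

lemma weight_locally_bounded:
  fixes \<kappa> :: "real^'n \<Rightarrow> real"
  assumes \<kappa>: "test_function \<kappa>" "\<kappa> 0 = 1" and t: "t \<in> I"
  shows "\<exists>R. \<forall>\<^sub>F s in at t within I. weight s \<le> R"
proof -
  from test_function_lipschitz[OF \<kappa>(1)] obtain L
    where L: "L > 0" "\<forall>x y. \<bar>\<kappa> y - \<kappa> x\<bar> \<le> L * norm (y - x)" by (elim exE conjE)
  (* With this scale the mass lost to the cutoff is at most L * e * weight t = 1 / 4. *)
  define e where "e = 1 / (4 * L * weight t)"
  have e: "0 < e" "L * e * weight t = 1 / 4" using L(1) weight_ge_1[OF t] by (simp_all add: e_def)
  define \<psi> where "\<psi> = (\<lambda>x. \<kappa> (e *\<^sub>R x))"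
  have \<psi>: "test_function \<psi>" unfolding \<psi>_def using e(1) by (intro test_function_dilate[OF \<kappa>(1)]) simp
  have "3 / 4 \<le> meas (\<rho> t) \<psi>"
  proof -
    interpret prob_space "\<rho> t" by (rule prob[OF t])
    have "(\<integral>x. 1 - L * e * (1 + norm x)\<^sup>2 \<partial>\<rho> t) \<le> (\<integral>x. \<psi> x \<partial>\<rho> t)"
    proof (rule integral_mono[OF _ test_function_integrable[OF P2[OF t] \<psi>]])
      show "integrable (\<rho> t) (\<lambda>x. 1 - L * e * (1 + norm x)\<^sup>2)" using weight_integrable[OF t] by simp
      fix x :: "real^'n"
      have "norm x \<le> (1 + norm x)\<^sup>2" using one_plus_norm_le_weight[of x] by linarith
      then have "L * e * norm x \<le> L * e * (1 + norm x)\<^sup>2" using L e by (intro mult_left_mono) auto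
      moreover have "\<bar>\<psi> x - 1\<bar> \<le> L * e * norm x"
        using L(2)[rule_format, of "e *\<^sub>R x" 0] \<kappa>(2) e(1) by (simp add: \<psi>_def mult_ac)
      ultimately show "1 - L * e * (1 + norm x)\<^sup>2 \<le> \<psi> x" by linarith
    qed
    also have "(\<integral>x. 1 - L * e * (1 + norm x)\<^sup>2 \<partial>\<rho> t) = 1 - L * e * weight t"
      using weight_integrable[OF t] by (simp add: prob_space)
    finally show ?thesis using e(2) by (simp add: meas_def)
  qed
  then have half: "\<forall>\<^sub>F s in at t within I. 1 / 2 < meas (\<rho> s) \<psi>"
    using DERIV_continuous[OF weak[OF \<psi> t]] unfolding continuous_within
    by (intro order_tendstoD(1)) auto
  define trc where "trc s = (\<Sum>i\<in>UNIV. cov (\<rho> s) $ i $ i)" for s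
  have "continuous_on I trc" unfolding trc_def
    by (intro continuous_on_sum continuous_on_component cov_cont)
  then have tr: "\<forall>\<^sub>F s in at t within I. trc s < trc t + 1"
    using t unfolding continuous_on_def by (intro order_tendstoD(2)) auto
  obtain m1 where M1: "m1 > 0" "\<forall>x. \<bar>\<psi> x\<bar> \<le> m1" using test_function_bounded[OF \<psi>] by (elim exE conjE)
  have "bounded {x. \<psi> x \<noteq> 0}" using \<psi> by (simp add: test_function_iff)
  then obtain r where r: "r > 0" "\<forall>x \<in> {x. \<psi> x \<noteq> 0}. norm x \<le> r"
    unfolding bounded_pos by (elim exE conjE)
  define \<tau> where "\<tau> = trc t + 1"
  have "\<forall>\<^sub>F s in at t within I. s \<in> I" by (auto simp: eventually_at_filter)
  with half tr have "\<forall>\<^sub>F s in at t within I. weight s \<le> 2 + 4 * (r + 1 + 2 * m1 * \<tau>)\<^sup>2 + 4 * \<tau>"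
  proof eventually_elim
    case (elim s)
    note s = P2[OF elim(3)]
    interpret prob_space "\<rho> s" by (rule prob[OF elim(3)])
    define m where "m = mean (\<rho> s)"
    have trs: "(\<integral>x. (norm (x - m))\<^sup>2 \<partial>\<rho> s) = trc s" by (simp add: trace_cov[OF s] trc_def m_def)
    have tau: "trc s \<le> \<tau>" using elim(2) by (simp add: \<tau>_def)
    have "0 \<le> trc s" unfolding trs[symmetric] by (rule Bochner_Integration.integral_nonneg) simp
    then have tau0: "0 \<le> \<tau>" using tau by simp
    have "norm m \<le> r + 1 + 2 * m1 * \<tau>"
    proof (cases "norm m \<le> r + 1")
      case True
      moreover have "0 \<le> 2 * m1 * \<tau>" using M1(1) tau0 by simp
      ultimately show ?thesis by linarith
    next
      case False
      define d where "d = norm m - r"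
      have d: "1 \<le> d" using False by (simp add: d_def)
      have "d\<^sup>2 * meas (\<rho> s) \<psi> = (\<integral>x. d\<^sup>2 * \<psi> x \<partial>\<rho> s)" by (simp add: meas_def)
      also have "\<dots> \<le> (\<integral>x. m1 * (norm (x - m))\<^sup>2 \<partial>\<rho> s)"
      proof (rule integral_mono)
        show "integrable (\<rho> s) (\<lambda>x. d\<^sup>2 * \<psi> x)" using test_function_integrable[OF s \<psi>] by simp
        have "integrable (\<rho> s) (\<lambda>x. (norm (x - m))\<^sup>2)"
          by (rule P2pos_integrable[OF s]) (use norm_diff_square_le in \<open>auto intro!: continuous_intros\<close>)
        then show "integrable (\<rho> s) (\<lambda>x. m1 * (norm (x - m))\<^sup>2)" by simp
        fix x
        show "d\<^sup>2 * \<psi> x \<le> m1 * (norm (x - m))\<^sup>2"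
        proof (cases "\<psi> x = 0")
          case True then show ?thesis using M1(1) by simp
        next
          case False
          then have "norm x \<le> r" using r(2) by simp
          then have "d \<le> norm (x - m)"
            using norm_triangle_ineq2[of m x] by (simp add: d_def norm_minus_commute)
          then have "d\<^sup>2 \<le> (norm (x - m))\<^sup>2" using d by (intro power_mono) auto
          then have "d\<^sup>2 * \<bar>\<psi> x\<bar> \<le> (norm (x - m))\<^sup>2 * m1"
            using M1(2) by (intro mult_mono) auto
          moreover have "d\<^sup>2 * \<psi> x \<le> d\<^sup>2 * \<bar>\<psi> x\<bar>" by (intro mult_left_mono) auto
          ultimately show ?thesis by (simp add: mult.commute)
        qed
      qed
      also have "\<dots> \<le> m1 * \<tau>" using tau M1(1) by (simp add: trs)
      finally have "d\<^sup>2 * meas (\<rho> s) \<psi> \<le> m1 * \<tau>" .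
      moreover have "d\<^sup>2 * (1 / 2) \<le> d\<^sup>2 * meas (\<rho> s) \<psi>" using elim(1) by (intro mult_left_mono) auto
      moreover have "d * 1 \<le> d * d" using d by (intro mult_left_mono) auto
      ultimately have "d \<le> 2 * m1 * \<tau>" by (simp add: power2_eq_square)
      then show ?thesis by (simp add: d_def)
    qed
    then have "(norm m)\<^sup>2 \<le> (r + 1 + 2 * m1 * \<tau>)\<^sup>2" by (rule power_mono) simp
    then show ?case using weight_integral_le[OF s] tau by (simp add: m_def trc_def)
  qed
  then show ?thesis by blast
qed

text \<open>
  On the coordinate function \<open>x\<^sub>k\<close> itself the generator is \<open>- (C M (x - x\<^sub>0))\<^sub>k\<close>, whose integral is the
  drift of the mean; a function that is close to \<open>x\<^sub>k\<close> in its first two derivatives misses this by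
  little.
\<close>

lemma fp_generator_near_drift:
  assumes t: "t \<in> I" and \<psi>: "test_function \<psi>" and d: "0 \<le> d"
    and \<beta>: "0 \<le> \<beta>" "\<forall>x. norm (M *v (x - x0)) \<le> \<beta> * (1 + norm x)"
    and b1: "\<forall>i x. \<bar>pderiv_at i \<psi> x - (if i = k then 1 else 0)\<bar> \<le> d * (1 + norm x)"
    and b2: "\<forall>i j x. \<bar>pderiv_at j (pderiv_at i \<psi>) x\<bar> \<le> d * (1 + norm x)"
  shows "\<bar>(\<integral>x. fp_generator (cov (\<rho> t)) (\<lambda>x. M *v (x - x0)) \<psi> x \<partial>\<rho> t)
            + (cov (\<rho> t) *v (M *v (mean (\<rho> t) - x0))) $ k\<bar>
       \<le> d * ((1 + \<beta>) * (\<Sum>i\<in>UNIV. \<Sum>j\<in>UNIV. \<bar>cov (\<rho> t) $ i $ j\<bar>) * weight t)"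
proof -
  interpret prob_space "\<rho> t" by (rule prob[OF t])
  let ?b = "\<lambda>x. M *v (x - x0)"
  define C where "C = cov (\<rho> t)"
  define S where "S = (\<Sum>i\<in>UNIV. \<Sum>j\<in>UNIV. \<bar>C $ i $ j\<bar>)"
  note intid = P2pos_integrable_id[OF P2[OF t]]
  note intgen = integrable_fp_generator[OF P2[OF t] \<psi>, of C M x0]
  define Lin where "Lin = (\<lambda>v. (C *v v) $ k)"
  have Lin: "bounded_linear Lin" unfolding Lin_def
    by (rule bounded_linear_compose[OF bounded_linear_vec_nth]) simp
  have intlin: "integrable (\<rho> t) (\<lambda>x. Lin (?b x))"
    by (rule integrable_bounded_linear[OF Lin integrable_affine_field[OF P2[OF t]]])
  have "(\<integral>x. ?b x \<partial>\<rho> t) = M *v (\<integral>x. x - x0 \<partial>\<rho> t)"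
    using intid by (intro integral_bounded_linear) auto
  also have "(\<integral>x. x - x0 \<partial>\<rho> t) = mean (\<rho> t) - x0"
    using intid by (simp add: mean_def prob_space)
  finally have "(\<integral>x. Lin (?b x) \<partial>\<rho> t) = Lin (M *v (mean (\<rho> t) - x0))"
    by (subst integral_bounded_linear[OF Lin integrable_affine_field[OF P2[OF t]]]) simp
  then have "(\<integral>x. fp_generator C ?b \<psi> x \<partial>\<rho> t) + (C *v (M *v (mean (\<rho> t) - x0))) $ k
      = (\<integral>x. fp_generator C ?b \<psi> x + Lin (?b x) \<partial>\<rho> t)"
    using intgen intlin by (simp add: Lin_def)
  also have "norm \<dots> \<le> (\<integral>x. norm (fp_generator C ?b \<psi> x + Lin (?b x)) \<partial>\<rho> t)"
    by (rule integral_norm_bound)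
  also have "\<dots> \<le> (\<integral>x. d * (1 + \<beta>) * S * (1 + norm x)\<^sup>2 \<partial>\<rho> t)"
  proof (rule integral_mono)
    show "integrable (\<rho> t) (\<lambda>x. norm (fp_generator C ?b \<psi> x + Lin (?b x)))"
      using intgen intlin by (intro integrable_norm Bochner_Integration.integrable_add)
    show "integrable (\<rho> t) (\<lambda>x. d * (1 + \<beta>) * S * (1 + norm x)\<^sup>2)"
      using weight_integrable[OF t] by simp
    fix x :: "real^'n"
    (* The generator plus the drift, written with the error of the first derivatives only. *)
    define D where "D i j = pderiv_at j (pderiv_at i \<psi>) x
        - ?b x $ j * (pderiv_at i \<psi> x - (if i = k then 1 else 0))" for i j
    have Dbound: "\<bar>D i j\<bar> \<le> d * (1 + \<beta>) * (1 + norm x)\<^sup>2" for i j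
    proof -
      have "\<bar>?b x $ j\<bar> \<le> \<beta> * (1 + norm x)"
        using \<beta>(2)[rule_format, of x] component_le_norm_cart[of "?b x" j] by linarith
      then have "\<bar>?b x $ j * (pderiv_at i \<psi> x - (if i = k then 1 else 0))\<bar>
          \<le> (\<beta> * (1 + norm x)) * (d * (1 + norm x))"
        unfolding abs_mult using b1 \<beta>(1) by (intro mult_mono) auto
      moreover have "\<bar>pderiv_at j (pderiv_at i \<psi>) x\<bar> \<le> d * (1 + norm x)\<^sup>2"
      proof (rule order_trans[OF b2[rule_format]])
        show "d * (1 + norm x) \<le> d * (1 + norm x)\<^sup>2"
          using d one_plus_norm_le_weight[of x] by (intro mult_left_mono) auto
      qed
      ultimately have "\<bar>D i j\<bar> \<le> d * (1 + norm x)\<^sup>2 + (\<beta> * (1 + norm x)) * (d * (1 + norm x))"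
        unfolding D_def by linarith
      then show ?thesis by (simp add: power2_eq_square algebra_simps)
    qed
    have "Lin (?b x) = (\<Sum>i\<in>UNIV. if i = k then (\<Sum>j\<in>UNIV. C $ i $ j * ?b x $ j) else 0)"
      by (simp add: Lin_def matrix_vector_mult_def[of C])
    also have "\<dots> = (\<Sum>i\<in>UNIV. \<Sum>j\<in>UNIV. C $ i $ j * (?b x $ j * (if i = k then 1 else 0)))"
      by (intro sum.cong) auto
    finally have "fp_generator C ?b \<psi> x + Lin (?b x) = (\<Sum>i\<in>UNIV. \<Sum>j\<in>UNIV. C $ i $ j * D i j)"
      unfolding fp_generator_def D_def
      by (simp only: sum.distrib[symmetric] distrib_left[symmetric]) (simp only: right_diff_distrib diff_diff_eq2 diff_add_eq)
    also have "norm \<dots> \<le> (\<Sum>i\<in>UNIV. \<Sum>j\<in>UNIV. norm (C $ i $ j * D i j))"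
      by (intro order_trans[OF norm_sum] sum_mono norm_sum)
    also have "\<dots> \<le> (\<Sum>i\<in>UNIV. \<Sum>j\<in>UNIV. \<bar>C $ i $ j\<bar> * (d * (1 + \<beta>) * (1 + norm x)\<^sup>2))"
      unfolding real_norm_def abs_mult by (intro sum_mono mult_left_mono Dbound) auto
    also have "\<dots> = d * (1 + \<beta>) * S * (1 + norm x)\<^sup>2"
      by (simp add: S_def sum_distrib_right sum_distrib_left mult_ac)
    finally show "norm (fp_generator C ?b \<psi> x + Lin (?b x)) \<le> d * (1 + \<beta>) * S * (1 + norm x)\<^sup>2" .
  qed
  also have "\<dots> = d * ((1 + \<beta>) * S * weight t)" by simp
  finally show ?thesis by (simp add: C_def S_def)
qed

abbreviation "drift t \<equiv> - (cov (\<rho> t) *v (M *v (mean (\<rho> t) - x0)))"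

text \<open>
  The mean value inequality for \<open>\<integral> \<psi> d\<rho>\<^sub>r - r c\<close> with \<open>\<psi>\<close> the cutoff coordinate, in which the scale \<open>e\<close>
  of the cutoff is sent to zero afterwards. All constants are uniform over \<open>N\<close>, so the limit costs
  nothing. The lemma is used twice: with \<open>c = 0\<close> it says that the mean is Lipschitz, and with \<open>c\<close> the
  drift at a point that the mean is differentiable there.
\<close>

lemma mean_increment_bound:
  fixes \<kappa> :: "real^'n \<Rightarrow> real"
  assumes \<kappa>: "test_function \<kappa>" "\<kappa> 0 = 1"
    and N: "N \<subseteq> I" "convex N" "s \<in> N" "t \<in> N"
    and R: "\<And>r. r \<in> N \<Longrightarrow> weight r \<le> R"
    and G: "\<And>r. r \<in> N \<Longrightarrow> (\<Sum>i\<in>UNIV. \<Sum>j\<in>UNIV. \<bar>cov (\<rho> r) $ i $ j\<bar>) \<le> G"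
    and c: "\<And>r. r \<in> N \<Longrightarrow> \<bar>drift r $ k - c\<bar> \<le> a"
  shows "\<bar>mean (\<rho> s) $ k - mean (\<rho> t) $ k - (s - t) * c\<bar> \<le> a * \<bar>s - t\<bar>"
proof -
  from cutoff_coordinate[OF \<kappa>] obtain K where K: "K > 0"
    "\<forall>e k. 0 < e \<and> e \<le> 1 \<longrightarrow> (\<exists>\<psi> :: real^'n \<Rightarrow> real. test_function \<psi>
    \<and> (\<forall>x. \<bar>\<psi> x - x $ k\<bar> \<le> e * K * (1 + norm x)\<^sup>2)
    \<and> (\<forall>i x. \<bar>pderiv_at i \<psi> x - (if i = k then 1 else 0)\<bar> \<le> e * K * (1 + norm x))
    \<and> (\<forall>i j x. \<bar>pderiv_at j (pderiv_at i \<psi>) x\<bar> \<le> e * K * (1 + norm x)))" by (elim exE conjE)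
  from affine_field_growth[of M x0] obtain \<beta>
    where \<beta>: "\<beta> > 0" "\<forall>x. norm (M *v (x - x0)) \<le> \<beta> * (1 + norm x)" by (elim exE conjE)
  define Z where "Z = K * ((1 + \<beta>) * G * R)"
  define h where "h = \<bar>mean (\<rho> s) $ k - mean (\<rho> t) $ k - (s - t) * c\<bar>"
  have approx: "h \<le> a * \<bar>s - t\<bar> + e * (Z * \<bar>s - t\<bar> + 2 * K * R)" if e: "0 < e" "e \<le> 1" for e
  proof -
    from K(2)[rule_format, of e k] e obtain \<psi> :: "real^'n \<Rightarrow> real" where \<psi>: "test_function \<psi>"
      and b0: "\<forall>x. \<bar>\<psi> x - x $ k\<bar> \<le> e * K * (1 + norm x)\<^sup>2"
      and b1: "\<forall>i x. \<bar>pderiv_at i \<psi> x - (if i = k then 1 else 0)\<bar> \<le> e * K * (1 + norm x)"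
      and b2: "\<forall>i j x. \<bar>pderiv_at j (pderiv_at i \<psi>) x\<bar> \<le> e * K * (1 + norm x)" by blast
    have eK: "0 \<le> e * K" using e K(1) by simp
    have near: "\<bar>meas (\<rho> r) \<psi> - mean (\<rho> r) $ k\<bar> \<le> e * K * R" if r: "r \<in> N" for r
    proof -
      have rI: "r \<in> I" using r N(1) by blast
      have ik: "integrable (\<rho> r) (\<lambda>x. x $ k)"
        by (rule integrable_bounded_linear[OF bounded_linear_vec_nth P2pos_integrable_id[OF P2[OF rI]]])
      note i\<psi> = test_function_integrable[OF P2[OF rI] \<psi>]
      have "meas (\<rho> r) \<psi> - mean (\<rho> r) $ k = (\<integral>x. \<psi> x - x $ k \<partial>\<rho> r)"
        using ik i\<psi> by (simp add: mean_nth[OF P2[OF rI]] meas_def)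
      also have "norm \<dots> \<le> (\<integral>x. norm (\<psi> x - x $ k) \<partial>\<rho> r)" by (rule integral_norm_bound)
      also have "\<dots> \<le> (\<integral>x. e * K * (1 + norm x)\<^sup>2 \<partial>\<rho> r)"
        using ik i\<psi> weight_integrable[OF rI] b0
        by (intro integral_mono integrable_norm Bochner_Integration.integrable_diff
            Bochner_Integration.integrable_mult_right) auto
      also have "\<dots> = e * K * weight r" by simp
      also have "\<dots> \<le> e * K * R" by (rule mult_left_mono[OF R[OF r] eK])
      finally show ?thesis by simp
    qed
    define g where "g r = (\<integral>x. fp_generator (cov (\<rho> r)) (\<lambda>x. M *v (x - x0)) \<psi> x \<partial>\<rho> r)" for r
    have gb: "norm (g r - c) \<le> a + e * Z" if r: "r \<in> N" for r
    proof -
      have rI: "r \<in> I" using r N(1) by blast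
      have "\<bar>g r - drift r $ k\<bar> \<le> e * K * ((1 + \<beta>) * (\<Sum>i\<in>UNIV. \<Sum>j\<in>UNIV. \<bar>cov (\<rho> r) $ i $ j\<bar>) * weight r)"
        using fp_generator_near_drift[OF rI \<psi> eK less_imp_le[OF \<beta>(1)] \<beta>(2) b1 b2] by (simp add: g_def)
      also have "\<dots> \<le> e * K * ((1 + \<beta>) * G * R)"
        using \<beta>(1) weight_ge_1[OF rI] G[OF r] R[OF r] sum_nonneg
        by (intro mult_left_mono[OF _ eK] mult_mono mult_nonneg_nonneg) (auto intro!: sum_nonneg order_trans[OF _ G[OF r]])
      also have "\<dots> = e * Z" by (simp add: Z_def)
      finally show ?thesis using c[OF r] unfolding real_norm_def by linarith
    qed
    have deriv: "((\<lambda>r. meas (\<rho> r) \<psi> - r * c) has_field_derivative (g r - c)) (at r within N)"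
      if r: "r \<in> N" for r
    proof -
      have "((\<lambda>r. meas (\<rho> r) \<psi>) has_field_derivative g r) (at r within N)"
        unfolding g_def using weak[OF \<psi>] r N(1) by (blast intro: DERIV_subset)
      then show ?thesis by (auto intro!: derivative_eq_intros)
    qed
    have "norm ((meas (\<rho> s) \<psi> - s * c) - (meas (\<rho> t) \<psi> - t * c)) \<le> (a + e * Z) * norm (s - t)"
      by (rule field_differentiable_bound[OF N(2) deriv gb N(3,4)])
    then have "\<bar>meas (\<rho> s) \<psi> - meas (\<rho> t) \<psi> - (s - t) * c\<bar> \<le> (a + e * Z) * \<bar>s - t\<bar>"
      by (simp add: algebra_simps)
    then have "h \<le> (a + e * Z) * \<bar>s - t\<bar> + (e * K * R + e * K * R)"
      using near[OF N(3)] near[OF N(4)] unfolding h_def by linarith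
    then show ?thesis by (simp add: algebra_simps)
  qed
  have "((\<lambda>e. a * \<bar>s - t\<bar> + e * (Z * \<bar>s - t\<bar> + 2 * K * R)) \<longlongrightarrow> a * \<bar>s - t\<bar> + 0 * (Z * \<bar>s - t\<bar> + 2 * K * R)) (at_right 0)"
    by (intro tendsto_intros)
  moreover have "\<forall>\<^sub>F e in at_right 0. h \<le> a * \<bar>s - t\<bar> + e * (Z * \<bar>s - t\<bar> + 2 * K * R)"
    unfolding eventually_at_right_field by (intro exI[of _ 1]) (auto intro!: approx)
  ultimately have "h \<le> a * \<bar>s - t\<bar> + 0 * (Z * \<bar>s - t\<bar> + 2 * K * R)"
    by (rule tendsto_lowerbound) simp
  then show ?thesis by (simp add: h_def)
qed

lemma local_bounds:
  fixes \<kappa> :: "real^'n \<Rightarrow> real"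
  assumes \<kappa>: "test_function \<kappa>" "\<kappa> 0 = 1" and t: "t \<in> I"
  shows "\<exists>\<delta>>0. \<exists>R G. \<forall>r \<in> I \<inter> ball t \<delta>. weight r \<le> R \<and> (\<Sum>i\<in>UNIV. \<Sum>j\<in>UNIV. \<bar>cov (\<rho> r) $ i $ j\<bar>) \<le> G"
proof -
  define S where "S r = (\<Sum>i\<in>UNIV. \<Sum>j\<in>UNIV. \<bar>cov (\<rho> r) $ i $ j\<bar>)" for r
  from weight_locally_bounded[OF \<kappa> t] obtain R where R: "\<forall>\<^sub>F s in at t within I. weight s \<le> R" ..
  have "continuous_on I S" unfolding S_def
    by (intro continuous_on_sum continuous_on_rabs continuous_on_component cov_cont)
  then have "\<forall>\<^sub>F s in at t within I. S s < S t + 1"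
    using t unfolding continuous_on_def by (intro order_tendstoD(2)) auto
  with R have "\<forall>\<^sub>F s in at t within I. weight s \<le> R \<and> S s < S t + 1" by (rule eventually_conj)
  then obtain \<delta> where \<delta>: "\<delta> > 0" "\<forall>s\<in>I. s \<noteq> t \<and> dist s t < \<delta> \<longrightarrow> weight s \<le> R \<and> S s < S t + 1"
    unfolding eventually_at by blast
  have "weight r \<le> max R (weight t) \<and> S r \<le> S t + 1" if "r \<in> I \<inter> ball t \<delta>" for r
  proof (cases "r = t")
    case False
    then have "weight r \<le> R \<and> S r < S t + 1" using that \<delta>(2) by (auto simp: dist_commute)
    then show ?thesis by auto
  qed simp
  then show ?thesis using \<delta>(1) unfolding S_def by blast
qed

lemma convex_nbhd: "convex (I \<inter> ball t \<delta>)"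
  using interval by (intro convex_Int) (auto simp: is_interval_convex)

lemma drift_bounded:
  assumes "r \<in> I" "weight r \<le> R" "(\<Sum>i\<in>UNIV. \<Sum>j\<in>UNIV. \<bar>cov (\<rho> r) $ i $ j\<bar>) \<le> G"
    and \<beta>: "\<beta> > 0" "\<forall>x. norm (M *v (x - x0)) \<le> \<beta> * (1 + norm x)"
  shows "\<bar>drift r $ k\<bar> \<le> G * (\<beta> * (1 + R))"
proof -
  let ?v = "M *v (mean (\<rho> r) - x0)" and ?C = "cov (\<rho> r)"
  have "norm ?v \<le> \<beta> * (1 + norm (mean (\<rho> r)))" using \<beta>(2) by blast
  also have "\<dots> \<le> \<beta> * (1 + R)"
    using norm_mean_le_weight[OF assms(1)] assms(2) \<beta>(1) by (intro mult_left_mono) auto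
  finally have v: "norm ?v \<le> \<beta> * (1 + R)" .
  have "\<bar>drift r $ k\<bar> = \<bar>\<Sum>j\<in>UNIV. ?C $ k $ j * ?v $ j\<bar>" by (simp add: matrix_vector_mult_def[of ?C])
  also have "\<dots> \<le> (\<Sum>j\<in>UNIV. \<bar>?C $ k $ j * ?v $ j\<bar>)" by (rule sum_abs)
  also have "\<dots> \<le> (\<Sum>j\<in>UNIV. \<bar>?C $ k $ j\<bar> * norm ?v)"
    unfolding abs_mult by (intro sum_mono mult_left_mono component_le_norm_cart) auto
  also have "\<dots> = (\<Sum>j\<in>UNIV. \<bar>?C $ k $ j\<bar>) * norm ?v" by (simp add: sum_distrib_right)
  also have "\<dots> \<le> G * (\<beta> * (1 + R))"
  proof (rule mult_mono)
    have "(\<Sum>j\<in>UNIV. \<bar>?C $ k $ j\<bar>) \<le> (\<Sum>i\<in>UNIV. \<Sum>j\<in>UNIV. \<bar>?C $ i $ j\<bar>)"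
      by (rule member_le_sum[of k UNIV "\<lambda>i. \<Sum>j\<in>UNIV. \<bar>?C $ i $ j\<bar>"]) (auto intro: sum_nonneg)
    then show "(\<Sum>j\<in>UNIV. \<bar>?C $ k $ j\<bar>) \<le> G" using assms(3) by linarith
    then show "0 \<le> G" by (rule order_trans[rotated]) (auto intro: sum_nonneg)
  qed (use v in auto)
  finally show ?thesis .
qed

text \<open>
  Boundedness of the drift makes the mean continuous, then the drift itself is continuous, and
  the increment bound applies with the value of the drift at \<open>t\<close>.
\<close>

lemma mean_has_derivative:
  fixes \<kappa> :: "real^'n \<Rightarrow> real"
  assumes \<kappa>: "test_function \<kappa>" "\<kappa> 0 = 1" and t: "t \<in> I"
  shows "((\<lambda>s. mean (\<rho> s) $ k) has_real_derivative drift t $ k) (at t within I)"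
proof -
  from local_bounds[OF \<kappa> t] obtain \<delta> R G where \<delta>: "\<delta> > 0"
    and b: "\<forall>r \<in> I \<inter> ball t \<delta>. weight r \<le> R \<and> (\<Sum>i\<in>UNIV. \<Sum>j\<in>UNIV. \<bar>cov (\<rho> r) $ i $ j\<bar>) \<le> G"
    by (elim exE conjE)
  from affine_field_growth[of M x0] obtain \<beta>
    where \<beta>: "\<beta> > 0" "\<forall>x. norm (M *v (x - x0)) \<le> \<beta> * (1 + norm x)" by (elim exE conjE)
  have tN: "t \<in> I \<inter> ball t d" if "d > 0" for d using t that by simp
  have lip: "\<bar>mean (\<rho> s) $ i - mean (\<rho> t) $ i\<bar> \<le> G * (\<beta> * (1 + R)) * \<bar>s - t\<bar>"
    if s: "s \<in> I \<inter> ball t \<delta>" for s i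
  proof -
    have "\<bar>mean (\<rho> s) $ i - mean (\<rho> t) $ i - (s - t) * 0\<bar> \<le> G * (\<beta> * (1 + R)) * \<bar>s - t\<bar>"
    proof (rule mean_increment_bound[OF \<kappa> _ convex_nbhd s tN[OF \<delta>]])
      show "\<bar>drift r $ i - 0\<bar> \<le> G * (\<beta> * (1 + R))" if "r \<in> I \<inter> ball t \<delta>" for r
        using drift_bounded[of r R G \<beta> i] b that \<beta> by auto
    qed (use b in auto)
    then show ?thesis by simp
  qed
  have cont: "((\<lambda>s. mean (\<rho> s) $ i) \<longlongrightarrow> mean (\<rho> t) $ i) (at t within I)" for i
  proof -
    have "((\<lambda>s. G * (\<beta> * (1 + R)) * \<bar>s - t\<bar>) \<longlongrightarrow> G * (\<beta> * (1 + R)) * \<bar>t - t\<bar>) (at t within I)"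
      by (intro tendsto_intros)
    then have z: "((\<lambda>s. G * (\<beta> * (1 + R)) * \<bar>s - t\<bar>) \<longlongrightarrow> 0) (at t within I)" by simp
    have "\<forall>\<^sub>F s in at t within I. norm (mean (\<rho> s) $ i - mean (\<rho> t) $ i) \<le> G * (\<beta> * (1 + R)) * \<bar>s - t\<bar>"
      unfolding eventually_at using \<delta> lip by (intro exI[of _ \<delta>]) (auto simp: dist_commute)
    from Lim_null_comparison[OF this z] show ?thesis by (simp only: Lim_null[symmetric])
  qed
  have "((\<lambda>s. mean (\<rho> s)) \<longlongrightarrow> mean (\<rho> t)) (at t within I)"
    by (rule vec_tendstoI) (rule cont)
  then have "((\<lambda>s. M *v (mean (\<rho> s) - x0)) \<longlongrightarrow> M *v (mean (\<rho> t) - x0)) (at t within I)"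
    by (intro bounded_linear.tendsto[OF matrix_vector_mul_bounded_linear] tendsto_intros)
  moreover have "((\<lambda>s. cov (\<rho> s)) \<longlongrightarrow> cov (\<rho> t)) (at t within I)"
    using cov_cont t by (simp add: continuous_on_def)
  ultimately have "((\<lambda>s. - (\<Sum>j\<in>UNIV. cov (\<rho> s) $ k $ j * (M *v (mean (\<rho> s) - x0)) $ j))
      \<longlongrightarrow> - (\<Sum>j\<in>UNIV. cov (\<rho> t) $ k $ j * (M *v (mean (\<rho> t) - x0)) $ j)) (at t within I)"
    by (intro tendsto_minus tendsto_sum tendsto_mult tendsto_vec_nth)
  then have drift_lim: "((\<lambda>s. drift s $ k) \<longlongrightarrow> drift t $ k) (at t within I)"
    by (simp add: matrix_vector_mult_def[of "cov _"])
  show ?thesis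
    unfolding has_field_derivative_def has_derivative_within_alt
  proof (intro conjI allI impI)
    show "bounded_linear ((*) (drift t $ k))" by (rule bounded_linear_mult_right)
    fix a :: real assume a: "a > 0"
    from tendstoD[OF drift_lim a] obtain d where d: "d > 0"
      "\<forall>s\<in>I. s \<noteq> t \<and> dist s t < d \<longrightarrow> dist (drift s $ k) (drift t $ k) < a"
      unfolding eventually_at by blast
    define d' where "d' = min d \<delta>"
    have d': "d' > 0" using d \<delta> by (simp add: d'_def)
    have close: "\<bar>drift r $ k - drift t $ k\<bar> \<le> a" if "r \<in> I \<inter> ball t d'" for r
    proof (cases "r = t")
      case False
      then have "dist (drift r $ k) (drift t $ k) < a" using that d(2) by (simp add: d'_def dist_commute)
      then show ?thesis by (simp add: dist_real_def)
    qed (use a in simp)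
    have "\<bar>mean (\<rho> s) $ k - mean (\<rho> t) $ k - (s - t) * drift t $ k\<bar> \<le> a * \<bar>s - t\<bar>"
      if s: "s \<in> I \<inter> ball t d'" for s
      by (rule mean_increment_bound[OF \<kappa> _ convex_nbhd s tN[OF d'] _ _ close, of R G])
        (use b in \<open>auto simp: d'_def\<close>)
    then show "\<exists>d>0. \<forall>y\<in>I. norm (y - t) < d \<longrightarrow>
        norm (mean (\<rho> y) $ k - mean (\<rho> t) $ k - drift t $ k * (y - t)) \<le> a * norm (y - t)"
      using d' by (intro exI[of _ d']) (auto simp: dist_real_def mult.commute abs_minus_commute)
  qed
qed

end

section \<open>The chain rule for a moving affine map\<close>

lemma pderiv_at_zero: "pderiv_at i (\<lambda>x. 0) = (\<lambda>x. 0)"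
  by (rule ext) (rule pderiv_at_eq, rule has_derivative_const)

lemma continuous_affine_map: "continuous_on UNIV (\<lambda>x::real^'n. P *v x + c :: real^'n)"
  by (intro continuous_on_add continuous_on_const bounded_linear.continuous_on[OF matrix_vector_mul_bounded_linear]
      continuous_on_id)

lemma norm_affine_difference_le:
  fixes P Q :: "real^'n^'n"
  shows "norm ((P *v x + p) - (Q *v x + q))
    \<le> ((\<Sum>i\<in>UNIV. \<Sum>j\<in>UNIV. \<bar>P $ i $ j - Q $ i $ j\<bar>) + (\<Sum>i\<in>UNIV. \<bar>p $ i - q $ i\<bar>)) * (1 + norm x)"
proof -
  have "norm ((P *v x + p) - (Q *v x + q)) \<le> (\<Sum>i\<in>UNIV. \<bar>((P *v x + p) - (Q *v x + q)) $ i\<bar>)"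
    by (rule norm_le_l1_cart)
  also have "\<dots> \<le> (\<Sum>i\<in>UNIV. ((\<Sum>j\<in>UNIV. \<bar>P $ i $ j - Q $ i $ j\<bar>) + \<bar>p $ i - q $ i\<bar>) * (1 + norm x))"
  proof (rule sum_mono)
    fix i
    have "((P *v x + p) - (Q *v x + q)) $ i = (\<Sum>j\<in>UNIV. (P $ i $ j - Q $ i $ j) * x $ j) + (p $ i - q $ i)"
      by (simp add: matrix_vector_mult_def left_diff_distrib sum_subtractf)
    also have "\<bar>\<dots>\<bar> \<le> (\<Sum>j\<in>UNIV. \<bar>(P $ i $ j - Q $ i $ j) * x $ j\<bar>) + \<bar>p $ i - q $ i\<bar>"
      by (rule order_trans[OF abs_triangle_ineq]) (intro add_right_mono sum_abs)
    also have "\<dots> \<le> (\<Sum>j\<in>UNIV. \<bar>P $ i $ j - Q $ i $ j\<bar> * (1 + norm x)) + \<bar>p $ i - q $ i\<bar> * (1 + norm x)"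
    proof (intro add_mono sum_mono)
      fix j
      have "\<bar>x $ j\<bar> \<le> 1 + norm x" using component_le_norm_cart[of x j] by simp
      then show "\<bar>(P $ i $ j - Q $ i $ j) * x $ j\<bar> \<le> \<bar>P $ i $ j - Q $ i $ j\<bar> * (1 + norm x)"
        unfolding abs_mult by (rule mult_left_mono) simp
      show "\<bar>p $ i - q $ i\<bar> \<le> \<bar>p $ i - q $ i\<bar> * (1 + norm x)"
        using mult_left_mono[of 1 "1 + norm x" "\<bar>p $ i - q $ i\<bar>"] by simp
    qed
    finally show "\<bar>((P *v x + p) - (Q *v x + q)) $ i\<bar>
        \<le> ((\<Sum>j\<in>UNIV. \<bar>P $ i $ j - Q $ i $ j\<bar>) + \<bar>p $ i - q $ i\<bar>) * (1 + norm x)"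
      by (simp add: distrib_right sum_distrib_right)
  qed
  also have "\<dots> = ((\<Sum>i\<in>UNIV. \<Sum>j\<in>UNIV. \<bar>P $ i $ j - Q $ i $ j\<bar>) + (\<Sum>i\<in>UNIV. \<bar>p $ i - q $ i\<bar>)) * (1 + norm x)"
    by (simp add: sum_distrib_right[symmetric] sum.distrib)
  finally show ?thesis .
qed

context affine_fokker_planck
begin

text \<open>
  Split \<open>\<phi> (P\<^sub>s x + q\<^sub>s)\<close> into its first-order Taylor polynomial around \<open>P\<^sub>t x + q\<^sub>t\<close> and a remainder. The
  Taylor polynomial is a finite sum of coefficients, differentiable in \<open>s\<close>, times fixed test
  functions, so the weak equation and the product rule differentiate its integral against \<open>\<rho>\<^sub>s\<close>.
  The remainder is of order \<open>E\<^sup>2 (1 + |x|)\<^sup>2\<close> where \<open>E\<close> measures the change of the coefficients, and its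
  integral is \<open>o (s - t)\<close>.
\<close>

lemma moving_affine_pairing:
  fixes \<kappa> \<phi> :: "real^'n \<Rightarrow> real" and P :: "real \<Rightarrow> real^'n^'n" and q :: "real \<Rightarrow> real^'n"
  assumes \<kappa>: "test_function \<kappa>" "\<kappa> 0 = 1" and t: "t \<in> I" and \<phi>: "test_function \<phi>"
    and inv: "Q ** P t = mat 1"
    and P': "\<And>i j. ((\<lambda>s. P s $ i $ j) has_real_derivative P' $ i $ j) (at t within I)"
    and q': "\<And>i. ((\<lambda>s. q s $ i) has_real_derivative q' $ i) (at t within I)"
  shows "((\<lambda>s. \<integral>x. \<phi> (P s *v x + q s) \<partial>\<rho> s) has_real_derivative
     (\<integral>x. fp_generator (cov (\<rho> t)) (\<lambda>x. M *v (x - x0)) (\<lambda>x. \<phi> (P t *v x + q t)) x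
        + (\<Sum>i\<in>UNIV. (P' *v x + q') $ i * pderiv_at i \<phi> (P t *v x + q t)) \<partial>\<rho> t)) (at t within I)"
proof -
  let ?y = "\<lambda>s x. P s *v x + q s"
  define g where "g i x = pderiv_at i \<phi> (?y t x)" for i x
  have g: "test_function (g i)" for i
    unfolding g_def by (rule test_function_affine[OF test_function_pderiv_at[OF \<phi>] inv])
  have xg: "test_function (\<lambda>x. x $ j * g i x)" for i j by (rule test_function_coordinate_mult[OF g])
  have \<phi>y: "test_function (\<lambda>x. \<phi> (?y t x))" by (rule test_function_affine[OF \<phi> inv])
  define F where "F s = (\<integral>x. \<phi> (?y s x) \<partial>\<rho> s)" for s
  (* F is the pairing itself; G replaces the integrand by its Taylor polynomial at time t. *)
  define G where "G s = meas (\<rho> s) (\<lambda>x. \<phi> (?y t x))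
      + ((\<Sum>i\<in>UNIV. \<Sum>j\<in>UNIV. (P s $ i $ j - P t $ i $ j) * meas (\<rho> s) (\<lambda>x. x $ j * g i x))
         + (\<Sum>i\<in>UNIV. (q s $ i - q t $ i) * meas (\<rho> s) (g i)))" for s
  define gen where "gen \<psi> = (\<integral>x. fp_generator (cov (\<rho> t)) (\<lambda>x. M *v (x - x0)) \<psi> x \<partial>\<rho> t)" for \<psi>
  have wk: "((\<lambda>s. meas (\<rho> s) \<psi>) has_real_derivative gen \<psi>) (at t within I)" if "test_function \<psi>" for \<psi>
    unfolding gen_def by (rule weak[OF that t])
  have prod: "((\<lambda>s. (u s - u t) * meas (\<rho> s) \<psi>) has_real_derivative u' * meas (\<rho> t) \<psi>) (at t within I)"
    if "(u has_real_derivative u') (at t within I)" "test_function \<psi>" for u u' \<psi>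
    using that(1) wk[OF that(2)] by (auto intro!: derivative_eq_intros)
  have G': "(G has_real_derivative gen (\<lambda>x. \<phi> (?y t x))
      + ((\<Sum>i\<in>UNIV. \<Sum>j\<in>UNIV. P' $ i $ j * meas (\<rho> t) (\<lambda>x. x $ j * g i x))
         + (\<Sum>i\<in>UNIV. q' $ i * meas (\<rho> t) (g i)))) (at t within I)"
    unfolding G_def by (intro DERIV_add DERIV_sum wk prod P' q' g xg \<phi>y)

  from test_function_taylor[OF \<phi>] obtain K where K: "K > 0"
    "\<forall>x y. \<bar>\<phi> y - \<phi> x - (\<Sum>i\<in>UNIV. (y - x) $ i * pderiv_at i \<phi> x)\<bar> \<le> K * (norm (y - x))\<^sup>2"
    by (elim exE conjE)
  define E where "E s = (\<Sum>i\<in>UNIV. \<Sum>j\<in>UNIV. \<bar>P s $ i $ j - P t $ i $ j\<bar>) + (\<Sum>i\<in>UNIV. \<bar>q s $ i - q t $ i\<bar>)" for s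
  have err: "\<bar>F s - G s\<bar> \<le> K * (E s)\<^sup>2 * weight s" if s: "s \<in> I" for s
  proof -
    note sP = P2[OF s]
    have i\<phi>: "integrable (\<rho> s) (\<lambda>x. \<phi> (?y s x))"
    proof -
      from test_function_bounded[OF \<phi>] obtain m1 where m1: "m1 > 0" "\<forall>x. \<bar>\<phi> x\<bar> \<le> m1" by (elim exE conjE)
      have "continuous_on UNIV (\<phi> \<circ> ?y s)"
        by (intro continuous_on_compose continuous_affine_map continuous_on_subset[OF test_function_continuous[OF \<phi>]]) simp
      then show ?thesis using m1(2) by (intro P2pos_integrable_bounded[OF sP, of _ m1]) (auto simp: o_def)
    qed
    note ints = i\<phi> test_function_integrable[OF sP \<phi>y] test_function_integrable[OF sP g] test_function_integrable[OF sP xg]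
    let ?lin = "\<lambda>x. (\<Sum>i\<in>UNIV. \<Sum>j\<in>UNIV. (P s $ i $ j - P t $ i $ j) * (x $ j * g i x))
        + (\<Sum>i\<in>UNIV. (q s $ i - q t $ i) * g i x)"
    have ilin: "integrable (\<rho> s) ?lin"
      by (intro Bochner_Integration.integrable_add Bochner_Integration.integrable_sum
          Bochner_Integration.integrable_mult_right ints(3,4))
    have "G s = (\<integral>x. \<phi> (?y t x) \<partial>\<rho> s) + (\<integral>x. ?lin x \<partial>\<rho> s)"
      using ints unfolding G_def meas_def by (simp add: Bochner_Integration.integral_sum)
    moreover have "(\<integral>x. \<phi> (?y s x) - \<phi> (?y t x) - ?lin x \<partial>\<rho> s)
        = F s - (\<integral>x. \<phi> (?y t x) \<partial>\<rho> s) - (\<integral>x. ?lin x \<partial>\<rho> s)"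
      unfolding F_def
      by (simp only: Bochner_Integration.integral_diff[OF
            Bochner_Integration.integrable_diff[OF ints(1,2)] ilin]
          Bochner_Integration.integral_diff[OF ints(1,2)])
    ultimately have FG: "F s - G s = (\<integral>x. \<phi> (?y s x) - \<phi> (?y t x) - ?lin x \<partial>\<rho> s)"
      by linarith
    have "norm (F s - G s) \<le> (\<integral>x. norm (\<phi> (?y s x) - \<phi> (?y t x) - ?lin x) \<partial>\<rho> s)"
      unfolding FG by (rule integral_norm_bound)
    also have "\<dots> \<le> (\<integral>x. K * (E s)\<^sup>2 * (1 + norm x)\<^sup>2 \<partial>\<rho> s)"
    proof (rule integral_mono)
      show "integrable (\<rho> s) (\<lambda>x. norm (\<phi> (?y s x) - \<phi> (?y t x) - ?lin x))"
        by (rule integrable_norm[OF Bochner_Integration.integrable_diff[OF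
              Bochner_Integration.integrable_diff[OF ints(1,2)] ilin]])
      show "integrable (\<rho> s) (\<lambda>x. K * (E s)\<^sup>2 * (1 + norm x)\<^sup>2)" using weight_integrable[OF s] by simp
      fix x :: "real^'n"
      have "?lin x = (\<Sum>i\<in>UNIV. (?y s x - ?y t x) $ i * pderiv_at i \<phi> (?y t x))"
        by (simp add: matrix_vector_mult_def g_def left_diff_distrib distrib_right sum_subtractf
            sum.distrib sum_distrib_right mult.assoc)
      then have "norm (\<phi> (?y s x) - \<phi> (?y t x) - ?lin x) \<le> K * (norm (?y s x - ?y t x))\<^sup>2"
        using K(2)[rule_format, of "?y s x" "?y t x"] by simp
      also have "\<dots> \<le> K * (E s * (1 + norm x))\<^sup>2"
        using K(1) norm_affine_difference_le[of "P s" x "q s" "P t" "q t"]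
        by (intro mult_left_mono power_mono) (auto simp: E_def)
      finally show "norm (\<phi> (?y s x) - \<phi> (?y t x) - ?lin x) \<le> K * (E s)\<^sup>2 * (1 + norm x)\<^sup>2"
        by (simp add: power_mult_distrib)
    qed
    finally show ?thesis by simp
  qed
  from weight_locally_bounded[OF \<kappa> t] obtain R where R: "\<forall>\<^sub>F s in at t within I. weight s \<le> R" ..
  have "((\<lambda>s. F s - G s) has_real_derivative 0) (at t within I)"
    unfolding has_field_derivative_iff
  proof (rule Lim_null_comparison)
    have Et: "E t = 0" by (simp add: E_def)
    then have Dt: "F t - G t = 0" using err[OF t] by simp
    have "\<forall>\<^sub>F s in at t within I. s \<in> I \<and> s \<noteq> t" by (auto simp: eventually_at_filter)
    with R show "\<forall>\<^sub>F s in at t within I. norm ((F s - G s - (F t - G t)) / (s - t)) \<le> K * R * (E s / \<bar>s - t\<bar> * E s)"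
    proof eventually_elim
      case (elim s)
      have "\<bar>F s - G s\<bar> \<le> K * (E s)\<^sup>2 * R"
        using err[of s] elim K(1) by (intro order_trans[OF err mult_left_mono]) auto
      then have "\<bar>F s - G s\<bar> / \<bar>s - t\<bar> \<le> K * (E s)\<^sup>2 * R / \<bar>s - t\<bar>" by (rule divide_right_mono) simp
      then show ?case unfolding Dt by (simp add: power2_eq_square mult_ac)
    qed
    have quot: "((\<lambda>s. \<bar>u s - u t\<bar> / \<bar>s - t\<bar>) \<longlongrightarrow> \<bar>u'\<bar>) (at t within I)"
      if "(u has_real_derivative u') (at t within I)" for u :: "real \<Rightarrow> real" and u'
      using tendsto_rabs[OF that[unfolded has_field_derivative_iff]] by simp
    have Equot: "E s / \<bar>s - t\<bar> = (\<Sum>i\<in>UNIV. \<Sum>j\<in>UNIV. \<bar>P s $ i $ j - P t $ i $ j\<bar> / \<bar>s - t\<bar>)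
        + (\<Sum>i\<in>UNIV. \<bar>q s $ i - q t $ i\<bar> / \<bar>s - t\<bar>)" for s
      by (simp add: E_def add_divide_distrib sum_divide_distrib)
    have l1: "((\<lambda>s. E s / \<bar>s - t\<bar>) \<longlongrightarrow> (\<Sum>i\<in>UNIV. \<Sum>j\<in>UNIV. \<bar>P' $ i $ j\<bar>) + (\<Sum>i\<in>UNIV. \<bar>q' $ i\<bar>)) (at t within I)"
      unfolding Equot by (intro tendsto_add tendsto_sum quot P' q')
    have lim: "(u \<longlongrightarrow> u t) (at t within I)"
      if "(u has_real_derivative u') (at t within I)" for u :: "real \<Rightarrow> real" and u'
      using DERIV_continuous[OF that] by (simp add: continuous_within)
    have "(E \<longlongrightarrow> (\<Sum>i\<in>UNIV. \<Sum>j\<in>UNIV. \<bar>P t $ i $ j - P t $ i $ j\<bar>) + (\<Sum>i\<in>UNIV. \<bar>q t $ i - q t $ i\<bar>)) (at t within I)"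
      unfolding E_def by (intro tendsto_add tendsto_sum tendsto_rabs tendsto_diff tendsto_const lim[OF P'] lim[OF q'])
    then have l2: "(E \<longlongrightarrow> 0) (at t within I)" by simp
    show "((\<lambda>s. K * R * (E s / \<bar>s - t\<bar> * E s)) \<longlongrightarrow> 0) (at t within I)"
      using tendsto_mult_left[OF tendsto_mult[OF l1 l2], of "K * R"] by simp
  qed
  from DERIV_add[OF this G'] have "(F has_real_derivative gen (\<lambda>x. \<phi> (?y t x))
      + ((\<Sum>i\<in>UNIV. \<Sum>j\<in>UNIV. P' $ i $ j * meas (\<rho> t) (\<lambda>x. x $ j * g i x))
         + (\<Sum>i\<in>UNIV. q' $ i * meas (\<rho> t) (g i)))) (at t within I)" by simp
  moreover have "gen (\<lambda>x. \<phi> (?y t x)) + ((\<Sum>i\<in>UNIV. \<Sum>j\<in>UNIV. P' $ i $ j * meas (\<rho> t) (\<lambda>x. x $ j * g i x))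
         + (\<Sum>i\<in>UNIV. q' $ i * meas (\<rho> t) (g i)))
      = (\<integral>x. fp_generator (cov (\<rho> t)) (\<lambda>x. M *v (x - x0)) (\<lambda>x. \<phi> (?y t x)) x
        + (\<Sum>i\<in>UNIV. (P' *v x + q') $ i * g i x) \<partial>\<rho> t)"
  proof -
    note ints = test_function_integrable[OF P2[OF t] g] test_function_integrable[OF P2[OF t] xg]
    have eq: "(\<Sum>i\<in>UNIV. (P' *v x + q') $ i * g i x)
        = (\<Sum>i\<in>UNIV. \<Sum>j\<in>UNIV. P' $ i $ j * (x $ j * g i x)) + (\<Sum>i\<in>UNIV. q' $ i * g i x)" for x
      by (simp add: matrix_vector_mult_def distrib_right sum.distrib sum_distrib_right mult.assoc)
    have i1: "integrable (\<rho> t) (\<lambda>x. \<Sum>i\<in>UNIV. \<Sum>j\<in>UNIV. P' $ i $ j * (x $ j * g i x))"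
      and i2: "integrable (\<rho> t) (\<lambda>x. \<Sum>i\<in>UNIV. q' $ i * g i x)"
      by (intro Bochner_Integration.integrable_sum Bochner_Integration.integrable_mult_right ints)+
    show ?thesis unfolding eq gen_def
      by (subst Bochner_Integration.integral_add[OF integrable_fp_generator[OF P2[OF t] \<phi>y]
            Bochner_Integration.integrable_add[OF i1 i2]],
          subst Bochner_Integration.integral_add[OF i1 i2])
        (simp add: Bochner_Integration.integral_sum ints meas_def)
  qed
  ultimately show ?thesis unfolding F_def g_def by simp
qed

end

text \<open>
  By the chain rule \<open>P\<close> enters once for each derivative: it pushes the drift forward and turns the
  diffusion matrix into \<open>P C P\<^sup>T\<close>, which is the identity for the normalization.
\<close>

lemma fp_generator_affine:
  fixes P C :: "real^'n^'n"
  assumes \<phi>: "test_function \<phi>" and inv: "Q ** P = mat 1"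
  shows "fp_generator C b (\<lambda>x. \<phi> (P *v x + c)) x =
     (\<Sum>k\<in>UNIV. \<Sum>l\<in>UNIV. (P ** C ** transpose P) $ k $ l * pderiv_at l (pderiv_at k \<phi>) (P *v x + c))
     - (\<Sum>k\<in>UNIV. (P *v (C *v b x)) $ k * pderiv_at k \<phi> (P *v x + c))"
proof -
  let ?y = "P *v x + c"
  note d1 = test_function_pderiv_at[OF \<phi>]
  have p1: "pderiv_at i (\<lambda>x. \<phi> (P *v x + c)) = (\<lambda>x. \<Sum>k\<in>UNIV. P $ k $ i * pderiv_at k \<phi> (P *v x + c))" for i
    by (rule ext, rule pderiv_at_affine[OF test_function_differentiable[OF \<phi>]])
  have p2: "pderiv_at j (pderiv_at i (\<lambda>x. \<phi> (P *v x + c))) x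
      = (\<Sum>k\<in>UNIV. P $ k $ i * (\<Sum>l\<in>UNIV. P $ l $ j * pderiv_at l (pderiv_at k \<phi>) ?y))" for i j
    unfolding p1
    by (subst pderiv_at_sum)
      (simp_all add: test_function_differentiable[OF test_function_affine[OF d1 inv]]
        pderiv_at_affine[OF test_function_differentiable[OF d1]])
  have first: "(\<Sum>i\<in>UNIV. \<Sum>j\<in>UNIV. C $ i $ j * (\<Sum>k\<in>UNIV. P $ k $ i * (\<Sum>l\<in>UNIV. P $ l $ j * H k l)))
      = (\<Sum>k\<in>UNIV. \<Sum>l\<in>UNIV. (P ** C ** transpose P) $ k $ l * H k l)" for H :: "'n \<Rightarrow> 'n \<Rightarrow> real"
  proof -
    have "(\<Sum>k\<in>UNIV. \<Sum>l\<in>UNIV. (P ** C ** transpose P) $ k $ l * H k l)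
        = (\<Sum>k\<in>UNIV. \<Sum>l\<in>UNIV. \<Sum>j\<in>UNIV. \<Sum>i\<in>UNIV. P $ k $ i * C $ i $ j * P $ l $ j * H k l)"
      by (simp add: matrix_matrix_mult_def transpose_def sum_distrib_right)
    also have "\<dots> = (\<Sum>k\<in>UNIV. \<Sum>j\<in>UNIV. \<Sum>l\<in>UNIV. \<Sum>i\<in>UNIV. P $ k $ i * C $ i $ j * P $ l $ j * H k l)"
      by (rule sum.cong[OF refl], rule sum.swap)
    also have "\<dots> = (\<Sum>k\<in>UNIV. \<Sum>j\<in>UNIV. \<Sum>i\<in>UNIV. \<Sum>l\<in>UNIV. P $ k $ i * C $ i $ j * P $ l $ j * H k l)"
      by (rule sum.cong[OF refl], rule sum.cong[OF refl], rule sum.swap)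
    also have "\<dots> = (\<Sum>k\<in>UNIV. \<Sum>i\<in>UNIV. \<Sum>j\<in>UNIV. \<Sum>l\<in>UNIV. P $ k $ i * C $ i $ j * P $ l $ j * H k l)"
      by (rule sum.cong[OF refl], rule sum.swap)
    also have "\<dots> = (\<Sum>i\<in>UNIV. \<Sum>k\<in>UNIV. \<Sum>j\<in>UNIV. \<Sum>l\<in>UNIV. P $ k $ i * C $ i $ j * P $ l $ j * H k l)"
      by (rule sum.swap)
    also have "\<dots> = (\<Sum>i\<in>UNIV. \<Sum>j\<in>UNIV. \<Sum>k\<in>UNIV. \<Sum>l\<in>UNIV. P $ k $ i * C $ i $ j * P $ l $ j * H k l)"
      by (rule sum.cong[OF refl], rule sum.swap)
    finally show ?thesis by (simp add: sum_distrib_left mult_ac)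
  qed
  have second: "(\<Sum>i\<in>UNIV. \<Sum>j\<in>UNIV. C $ i $ j * (v $ j * (\<Sum>k\<in>UNIV. P $ k $ i * h k)))
      = (\<Sum>k\<in>UNIV. (P *v (C *v v)) $ k * h k)" for v :: "real^'n" and h :: "'n \<Rightarrow> real"
  proof -
    have "(\<Sum>k\<in>UNIV. (P *v (C *v v)) $ k * h k)
        = (\<Sum>k\<in>UNIV. \<Sum>i\<in>UNIV. \<Sum>j\<in>UNIV. P $ k $ i * (C $ i $ j * v $ j) * h k)"
      by (simp add: matrix_vector_mult_def sum_distrib_right sum_distrib_left)
    also have "\<dots> = (\<Sum>i\<in>UNIV. \<Sum>k\<in>UNIV. \<Sum>j\<in>UNIV. P $ k $ i * (C $ i $ j * v $ j) * h k)"
      by (rule sum.swap)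
    also have "\<dots> = (\<Sum>i\<in>UNIV. \<Sum>j\<in>UNIV. \<Sum>k\<in>UNIV. P $ k $ i * (C $ i $ j * v $ j) * h k)"
      by (rule sum.cong[OF refl], rule sum.swap)
    finally show ?thesis by (simp add: sum_distrib_left mult_ac)
  qed
  show ?thesis
    unfolding fp_generator_def p2 right_diff_distrib sum_subtractf first
    by (simp only: p1 second)
qed

text \<open>
  The pushed-forward measure is eliminated at once, so that integrability is only ever needed
  with respect to \<open>\<mu>\<close>.
\<close>

lemma ornstein_uhlenbeck_rhs:
  fixes P :: "real^'n^'n"
  assumes \<mu>: "\<mu> \<in> P2pos" and \<phi>: "test_function \<phi>" and inv: "Q ** P = mat 1"
    and \<eta>: "\<eta> = distr \<mu> borel (\<lambda>x. P *v (x - m))"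
  shows "dlaplace (meas \<eta>) \<phi> + ddiv (meas_field (\<lambda>x. x) \<eta>) \<phi>
    = (\<integral>x. (\<Sum>k\<in>UNIV. pderiv_at k (pderiv_at k \<phi>) (P *v (x - m)))
          - (\<Sum>k\<in>UNIV. (P *v (x - m)) $ k * pderiv_at k \<phi> (P *v (x - m))) \<partial>\<mu>)"
proof -
  let ?T = "\<lambda>x. P *v (x - m)"
  have sets: "sets \<mu> = sets borel" using \<mu> by (simp add: P2pos_def)
  have T: "?T \<in> measurable \<mu> borel"
    using borel_measurable_continuous_onI[OF continuous_affine_field] sets by (simp cong: measurable_cong_sets)
  have tT: "test_function (\<lambda>x. \<psi> (?T x))" if "test_function \<psi>" for \<psi>
    using test_function_affine[OF that inv, of "- (P *v m)"] by (simp add: matrix_vector_mult_diff_distrib)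
  have distr: "integral\<^sup>L \<eta> f = (\<integral>x. f (?T x) \<partial>\<mu>)" if "continuous_on UNIV f"
    for f :: "real^'n \<Rightarrow> 'b::{banach, second_countable_topology}"
    unfolding \<eta> by (rule integral_distr[OF T borel_measurable_continuous_onI[OF that]])
  note d1 = test_function_pderiv_at[OF \<phi>]
  note d2 = test_function_pderiv_at[OF d1]
  have lap: "dlaplace (meas \<eta>) \<phi> = (\<Sum>k\<in>UNIV. \<integral>x. pderiv_at k (pderiv_at k \<phi>) (?T x) \<partial>\<mu>)"
    by (simp add: dlaplace_def ddiv_def dgrad_def meas_def distr[OF test_function_continuous[OF d2]] sum_negf)
  have fld: "meas_field (\<lambda>x. x) \<eta> (pderiv_at k \<phi>) $ k = (\<integral>x. ?T x $ k * pderiv_at k \<phi> (?T x) \<partial>\<mu>)" for k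
  proof -
    have "meas_field (\<lambda>x. x) \<eta> (pderiv_at k \<phi>) = (\<integral>x. pderiv_at k \<phi> (?T x) *\<^sub>R ?T x \<partial>\<mu>)"
      unfolding meas_field_def
      by (rule distr) (intro continuous_on_scaleR test_function_continuous[OF d1] continuous_on_id)
    then show ?thesis
      by (simp add: integral_bounded_linear[OF bounded_linear_vec_nth
            integrable_test_function_affine_field[OF \<mu> tT[OF d1]], symmetric] mult.commute)
  qed
  have i1: "integrable \<mu> (\<lambda>x. pderiv_at k (pderiv_at k \<phi>) (?T x))" for k
    by (rule test_function_integrable[OF \<mu> tT[OF d2]])
  have i2: "integrable \<mu> (\<lambda>x. ?T x $ k * pderiv_at k \<phi> (?T x))" for k
    by (rule integrable_fp_term[OF \<mu> tT[OF d1]])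
  have "dlaplace (meas \<eta>) \<phi> + ddiv (meas_field (\<lambda>x. x) \<eta>) \<phi>
      = (\<Sum>k\<in>UNIV. \<integral>x. pderiv_at k (pderiv_at k \<phi>) (?T x) \<partial>\<mu>)
        - (\<Sum>k\<in>UNIV. \<integral>x. ?T x $ k * pderiv_at k \<phi> (?T x) \<partial>\<mu>)"
    by (simp add: lap ddiv_def fld)
  also have "\<dots> = (\<integral>x. (\<Sum>k\<in>UNIV. pderiv_at k (pderiv_at k \<phi>) (?T x))
          - (\<Sum>k\<in>UNIV. ?T x $ k * pderiv_at k \<phi> (?T x)) \<partial>\<mu>)"
    using i1 i2
    by (subst Bochner_Integration.integral_diff)
      (auto intro!: Bochner_Integration.integrable_sum simp: Bochner_Integration.integral_sum)
  finally show ?thesis .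
qed

section \<open>The normalized solution\<close>

theorem lemma4p2:
  fixes x0 :: "real^'n" and B :: "real^'n^'n"
    and I :: "real set"
    and \<rho> :: "real \<Rightarrow> (real^'n) measure"
    and A A' C' :: "real \<Rightarrow> real^'n^'n"
  assumes B: "pos_def B"
    and I: "is_interval I"
    and \<rho>: "\<And>t. t \<in> I \<Longrightarrow> \<rho> t \<in> P2pos"
    and sol: "solves_cov_fokker_planck x0 B \<rho> I"
    and sqrt: "\<And>t. t \<in> I \<Longrightarrow> A t ** transpose (A t) = cov (\<rho> t)"
    and A': "\<And>t. t \<in> I \<Longrightarrow> (A has_vector_derivative A' t) (at t within I)"
    and C': "\<And>t. t \<in> I \<Longrightarrow> ((\<lambda>s. cov (\<rho> s)) has_vector_derivative C' t) (at t within I)"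
    and ode1: "\<And>t. t \<in> I \<Longrightarrow> matrix_inv (A t) ** A' t =
                 (1/2) *\<^sub>R (matrix_inv (A t) ** C' t ** transpose (matrix_inv (A t)))"
    and ode2: "\<And>t. t \<in> I \<Longrightarrow> (1/2) *\<^sub>R (matrix_inv (A t) ** C' t ** transpose (matrix_inv (A t))) =
                 mat 1 - transpose (A t) ** matrix_inv B ** A t"
  shows "solves_ornstein_uhlenbeck
           (\<lambda>t. distr (\<rho> t) borel (normalization (mean (\<rho> t)) (A t))) I"
proof -
  interpret affine_fokker_planck "matrix_inv B" x0 \<rho> I
  proof
    show "continuous_on I (\<lambda>s. cov (\<rho> s))"
      unfolding continuous_on_eq_continuous_within
      using has_vector_derivative_continuous[OF C'] by blast
    show "((\<lambda>s. meas (\<rho> s) \<psi>) has_real_derivative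
        (\<integral>x. fp_generator (cov (\<rho> t)) (\<lambda>x. matrix_inv B *v (x - x0)) \<psi> x \<partial>\<rho> t)) (at t within I)"
      if "test_function \<psi>" "t \<in> I" for \<psi> t
      using sol that unfolding fokker_planck_rhs[OF \<rho>[OF that(2)] that(1), symmetric]
        solves_cov_fokker_planck_def has_time_derivative_def by blast
  qed (use I \<rho> in auto)
  define \<eta> where "\<eta> = (\<lambda>t. distr (\<rho> t) borel (normalization (mean (\<rho> t)) (A t)))"
  define P where "P = (\<lambda>t. matrix_inv (A t))"
  have P_apply: "matrix_inv (A s) = P s" for s by (simp add: P_def)
  define q where "q = (\<lambda>t. - (P t *v mean (\<rho> t)))"
  have inv: "invertible (A t)" if "t \<in> I" for t
    using \<rho>[OF that] pos_def_factor_invertible[OF _ sqrt[OF that]] by (simp add: P2pos_def)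
  have PA: "P t ** A t = mat 1" "A t ** P t = mat 1" if "t \<in> I" for t
    using matrix_inv_inverse[OF inv[OF that]] by (simp_all add: P_def)
  have norm_eq: "normalization (mean (\<rho> t)) (A t) = (\<lambda>x. P t *v (x - mean (\<rho> t)))" for t
    by (rule ext) (simp add: normalization_def P_def)
  have affine: "P t *v (x - mean (\<rho> t)) = P t *v x + q t" for x t
    by (simp add: q_def matrix_vector_mult_diff_distrib)
  have meas_\<eta>: "meas (\<eta> t) \<phi> = (\<integral>x. \<phi> (P t *v x + q t) \<partial>\<rho> t)"
    if "test_function \<phi>" "t \<in> I" for \<phi> t
  proof -
    have "sets (\<rho> t) = sets borel" using \<rho>[OF that(2)] by (simp add: P2pos_def)
    then have "(\<lambda>x. P t *v (x - mean (\<rho> t))) \<in> measurable (\<rho> t) borel"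
      using borel_measurable_continuous_onI[OF continuous_affine_field] by (simp cong: measurable_cong_sets)
    from integral_distr[OF this borel_measurable_continuous_onI[OF test_function_continuous[OF that(1)]]]
    show ?thesis by (simp only: meas_def \<eta>_def norm_eq affine)
  qed
  have "((\<lambda>s. meas (\<eta> s) \<phi>) has_real_derivative
      dlaplace (meas (\<eta> t)) \<phi> + ddiv (meas_field (\<lambda>x. x) (\<eta> t)) \<phi>) (at t within I)"
    if \<phi>: "test_function \<phi>" and t: "t \<in> I" for \<phi> t
  proof (cases "\<exists>y0. \<phi> y0 \<noteq> 0")
    case False
    then have "\<phi> = (\<lambda>x. 0)" by auto
    then show ?thesis
      by (simp add: dlaplace_def ddiv_def dgrad_def meas_def meas_field_def pderiv_at_zero)
  next
    case True
    then obtain y0 where y0: "\<phi> y0 \<noteq> 0" ..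
    (* The given test function, recentred and normalized, serves as the cutoff for the mean. *)
    define \<kappa> where "\<kappa> = (\<lambda>x. (1 / \<phi> y0) * \<phi> (mat 1 *v x + y0))"
    have \<kappa>: "test_function \<kappa>" unfolding \<kappa>_def
      by (rule test_function_scale[OF test_function_affine[OF \<phi>, of "mat 1"]]) simp
    have \<kappa>0: "\<kappa> 0 = 1" using y0 by (simp add: \<kappa>_def)
    let ?m = "mean (\<rho> t)" and ?At = "transpose (A t)" and ?Bi = "matrix_inv B"
    have neg: "(- N) *v v = - (N *v v)" "N *v (- v) = - (N *v v)" for N :: "real^'n^'n" and v
      by (simp_all add: matrix_vector_mult_def vec_eq_iff sum_negf)
    define S where "S = mat 1 - ?At ** ?Bi ** A t"
    have PA': "P t ** A' t = S" using ode1[OF t] ode2[OF t] by (simp add: P_def S_def)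
    define P' where "P' = - (S ** P t)"
    have derivP: "(P has_vector_derivative P') (at t within I)"
      using has_vector_derivative_matrix_inv[of I A, OF inv t A'[OF t]]
      by (simp add: P_apply PA' P'_def)
    have derivP': "((\<lambda>s. P s $ i $ j) has_real_derivative P' $ i $ j) (at t within I)" for i j
      unfolding has_real_derivative_iff_has_vector_derivative
      by (intro bounded_linear.has_vector_derivative[OF bounded_linear_vec_nth] derivP)
    define q' where "q' = - (P' *v ?m + P t *v drift t)"
    have derivq: "((\<lambda>s. q s $ i) has_real_derivative q' $ i) (at t within I)" for i
    proof -
      have "((\<lambda>s. - (\<Sum>j\<in>UNIV. P s $ i $ j * mean (\<rho> s) $ j)) has_real_derivative
          - (\<Sum>j\<in>UNIV. P' $ i $ j * ?m $ j + drift t $ j * P t $ i $ j)) (at t within I)"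
        by (intro DERIV_minus DERIV_sum DERIV_mult derivP' mean_has_derivative[OF \<kappa> \<kappa>0 t])
      moreover have "- (\<Sum>j\<in>UNIV. P' $ i $ j * ?m $ j + drift t $ j * P t $ i $ j) = q' $ i"
        by (simp add: q'_def matrix_vector_mult_def[of P'] matrix_vector_mult_def[of "P t"]
            sum.distrib sum_subtractf mult.commute sum_negf)
      moreover have "(\<lambda>s. - (\<Sum>j\<in>UNIV. P s $ i $ j * mean (\<rho> s) $ j)) = (\<lambda>s. q s $ i)"
        by (simp add: q_def matrix_vector_mult_def)
      ultimately show ?thesis by simp
    qed
    have PC: "P t ** cov (\<rho> t) = ?At"
      by (simp add: sqrt[OF t, symmetric] matrix_mul_assoc PA[OF t])
    have PCP: "P t ** cov (\<rho> t) ** transpose (P t) = mat 1"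
      by (simp add: PC matrix_transpose_mul[symmetric] PA[OF t] transpose_mat)
    have integrand: "fp_generator (cov (\<rho> t)) (\<lambda>x. ?Bi *v (x - x0)) (\<lambda>x. \<phi> (P t *v x + q t)) x
        + (\<Sum>i\<in>UNIV. (P' *v x + q') $ i * pderiv_at i \<phi> (P t *v x + q t))
      = (\<Sum>k\<in>UNIV. pderiv_at k (pderiv_at k \<phi>) (P t *v (x - ?m)))
          - (\<Sum>k\<in>UNIV. (P t *v (x - ?m)) $ k * pderiv_at k \<phi> (P t *v (x - ?m)))" for x
    proof -
      define y where "y = P t *v (x - ?m)"
      have Ay: "A t *v y = x - ?m"
        by (simp only: y_def matrix_vector_mul_assoc PA[OF t] matrix_vector_mul_lid)
      have yq: "P t *v x + q t = y" by (simp only: y_def affine)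
      have PCv: "P t *v (cov (\<rho> t) *v v) = ?At *v v" for v
        by (simp only: matrix_vector_mul_assoc PC)
      (* The velocity of the normalization; its second term cancels the transported drift below. *)
      have "P' *v x + q' = P' *v (x - ?m) - P t *v drift t"
        by (simp add: q'_def matrix_vector_mult_diff_distrib)
      also have "P' *v (x - ?m) = - (S *v y)"
        by (simp only: P'_def y_def neg matrix_vector_mul_assoc)
      also have "P t *v drift t = - (?At *v (?Bi *v (?m - x0)))"
        by (simp only: neg PCv)
      also have "S *v y = y - ?At *v (?Bi *v (A t *v y))"
        by (simp only: S_def matrix_vector_mult_diff_rdistrib matrix_vector_mul_lid
            matrix_vector_mul_assoc matrix_mul_assoc)
      also have "- (y - ?At *v (?Bi *v (A t *v y))) - - (?At *v (?Bi *v (?m - x0)))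
          = - y + (?At *v (?Bi *v (A t *v y)) + ?At *v (?Bi *v (?m - x0)))" by simp
      also have "?At *v (?Bi *v (A t *v y)) + ?At *v (?Bi *v (?m - x0)) = ?At *v (?Bi *v (x - x0))"
        by (simp only: matrix_vector_right_distrib[symmetric] Ay) simp
      finally have drift: "P' *v x + q' = - y + ?At *v (?Bi *v (x - x0))" .
      have "fp_generator (cov (\<rho> t)) (\<lambda>x. ?Bi *v (x - x0)) (\<lambda>x. \<phi> (P t *v x + q t)) x
          = (\<Sum>k\<in>UNIV. \<Sum>l\<in>UNIV. mat 1 $ k $ l * pderiv_at l (pderiv_at k \<phi>) y)
            - (\<Sum>k\<in>UNIV. (?At *v (?Bi *v (x - x0))) $ k * pderiv_at k \<phi> y)"
        by (subst fp_generator_affine[OF \<phi> PA(2)[OF t]]) (simp only: PCP PCv yq)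
      also have "(\<Sum>k\<in>UNIV. \<Sum>l\<in>UNIV. mat 1 $ k $ l * pderiv_at l (pderiv_at k \<phi>) y)
          = (\<Sum>k\<in>UNIV. pderiv_at k (pderiv_at k \<phi>) y)"
        by (simp add: mat_nth if_distrib[of "\<lambda>z. z * _"] cong: if_cong)
      finally show ?thesis
        unfolding drift yq y_def[symmetric]
        by (simp add: distrib_right left_diff_distrib sum.distrib sum_subtractf sum_negf)
    qed
    have "((\<lambda>s. \<integral>x. \<phi> (P s *v x + q s) \<partial>\<rho> s) has_real_derivative
        dlaplace (meas (\<eta> t)) \<phi> + ddiv (meas_field (\<lambda>x. x) (\<eta> t)) \<phi>) (at t within I)"
      using moving_affine_pairing[OF \<kappa> \<kappa>0 t \<phi> PA(2)[OF t] derivP' derivq]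
      unfolding integrand
        ornstein_uhlenbeck_rhs[OF \<rho>[OF t] \<phi> PA(2)[OF t], where m = ?m and \<eta> = "\<eta> t",
          OF \<eta>_def[THEN fun_cong, unfolded norm_eq]] .
    then show ?thesis
      by (rule has_field_derivative_transform_within[OF _ zero_less_one t]) (simp add: meas_\<eta>[OF \<phi>])
  qed
  then show ?thesis
    unfolding solves_ornstein_uhlenbeck_def has_time_derivative_def \<eta>_def by blast
qed

end
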